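(* Let $(\Omega,d,\mu)$ be an $RD$-space with indices $(k,n)$ which satisfies the non-collapsing property, $X$ an r.i. space on $\Omega$ and $f\in X\cap L^\infty$. Then, for $\mu$-almost every $x,y\in\Omega$, $$|f(x)-f(y)|\preceq\int_0^{8d(x,y)}\frac{E_X(f,s)}{\varphi_X\left(\min(s^k,s^n)\right)}\frac{ds}{s},$$ with implicit constant independent of $f$, $x$, $y$. In particular, if $$\int_0^1\frac{E_X(f,s)}{\varphi_X(s^n)}\frac{ds}{s}<\infty,$$ then $f$ is essentially continuous.
   Context: Metric measure space: $(\Omega,d)$ is a metric space with a Borel measure $\mu$ (induced by a Borel regular outer measure) such that $0<\mu(B)<\infty$ for every ball $B$ and $\mu(\{x\})=0$ for all $x\in\Omega$; $B(x,r)=\{y:d(x,y)<r\}$. It is an $RD$-space with indices $(k,n)$, $0<k\le n$, if there are constants $0<C_1\le 1\le C_2$ with $C_1\lambda^k\mu(B(x,r))\le\mu(B(x,\lambda r))\le C_2\lambda^n\mu(B(x,r))$ for all $x\in\Omega$, $r>0$, $\lambda\ge1$. Non-collapsing property: $\inf_{x\in\Omega}\mu(B(x,1))>0$. R.i. space: a Banach function space $X$ on $(\Omega,\mu)$ with the Fatou property such that, if $g\in X$ and $f^*\le g^*$ a.e., then $f\in X$ and $\|f\|_X\le\|g\|_X$; here $f^*(s)=\inf\{t\ge0:\mu\{|f|>t\}\le s\}$ is the decreasing rearrangement. Fundamental function: $\varphi_X(t)=\|\chi_F\|_X$ for any measurable $F$ with $\mu(F)=t$. $E_X(f,t)=\left\|x\mapsto\frac1{\mu(B(x,t))}\int_{B(x,t)}|f(x)-f(y)|\,d\mu(y)\right\|_X$.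 Essentially continuous means equal $\mu$-a.e. to a continuous function. $A\preceq B$ means $A\le CB$ for a constant $C>0$. *)

theory Defs
  imports "HOL-Analysis.Analysis"
begin

definition borel_regular_outer_measure :: "('a::topological_space set \<Rightarrow> ennreal) \<Rightarrow> bool" where
  "borel_regular_outer_measure \<nu> \<longleftrightarrow>
     outer_measure_space (Pow UNIV) \<nu> \<and>
     sets borel \<subseteq> lambda_system UNIV (Pow UNIV) \<nu> \<and>
     (\<forall>A. \<exists>B\<in>sets borel. A \<subseteq> B \<and> \<nu> B = \<nu> A)"

text \<open>The sigma-algebra of \<open>M\<close> may be anything between the Borel sets and the
  Caratheodory-measurable sets of \<open>\<nu>\<close>. In particular \<open>space M = UNIV\<close>.\<close>

definition metric_measure_space :: "'a::metric_space measure \<Rightarrow> bool" where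
  "metric_measure_space M \<longleftrightarrow>
     (\<exists>\<nu>. borel_regular_outer_measure \<nu> \<and>
        sets borel \<subseteq> sets M \<and> sets M \<subseteq> lambda_system UNIV (Pow UNIV) \<nu> \<and>
        (\<forall>A\<in>sets M. emeasure M A = \<nu> A)) \<and>
     (\<forall>x r. 0 < r \<longrightarrow> 0 < emeasure M (ball x r) \<and> emeasure M (ball x r) < \<infinity>) \<and>
     (\<forall>x. emeasure M {x} = 0)"

definition RD_space :: "'a::metric_space measure \<Rightarrow> real \<Rightarrow> real \<Rightarrow> bool" where
  "RD_space M k n \<longleftrightarrow>
     metric_measure_space M \<and> 0 < k \<and> k \<le> n \<and>
     (\<exists>C1 C2. 0 < C1 \<and> C1 \<le> 1 \<and> 1 \<le> C2 \<and>
       (\<forall>x r l. 0 < r \<and> 1 \<le> l \<longrightarrow>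
          ennreal (C1 * l powr k) * emeasure M (ball x r) \<le> emeasure M (ball x (l * r)) \<and>
          emeasure M (ball x (l * r)) \<le> ennreal (C2 * l powr n) * emeasure M (ball x r)))"

definition non_collapsing :: "'a::metric_space measure \<Rightarrow> bool" where
  "non_collapsing M \<longleftrightarrow> 0 < (INF x. emeasure M (ball x 1))"

text \<open>A Banach function space with the Fatou property is given by its function norm \<open>N\<close> on
  the nonnegative extended-valued measurable functions, following the axioms of Bennett and
  Sharpley; the values of \<open>N\<close> on non-measurable functions are irrelevant. The space itself is
  \<open>bfs M N\<close>, with \<open>N\<close> infinite on functions outside it.\<close>

definition banach_function_norm :: "'a measure \<Rightarrow> (('a \<Rightarrow> ennreal) \<Rightarrow> ennreal) \<Rightarrow> bool" where
  "banach_function_norm M N \<longleftrightarrow>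
     (\<forall>f\<in>borel_measurable M. N f = 0 \<longleftrightarrow> (AE x in M. f x = 0)) \<and>
     (\<forall>f\<in>borel_measurable M. \<forall>c::real. 0 \<le> c \<longrightarrow> N (\<lambda>x. ennreal c * f x) = ennreal c * N f) \<and>
     (\<forall>f\<in>borel_measurable M. \<forall>g\<in>borel_measurable M. N (\<lambda>x. f x + g x) \<le> N f + N g) \<and>
     (\<forall>f\<in>borel_measurable M. \<forall>g\<in>borel_measurable M. (AE x in M. f x \<le> g x) \<longrightarrow> N f \<le> N g) \<and>
     (\<forall>F f. (\<forall>i::nat. F i \<in> borel_measurable M) \<and> f \<in> borel_measurable M \<and>
        (AE x in M. incseq (\<lambda>i. F i x) \<and> (SUP i. F i x) = f x) \<longrightarrow> (SUP i. N (F i)) = N f) \<and>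
     (\<forall>A\<in>sets M. emeasure M A < \<infinity> \<longrightarrow> N (indicator A) < \<infinity>) \<and>
     (\<forall>A\<in>sets M. emeasure M A < \<infinity> \<longrightarrow>
        (\<exists>C::real. \<forall>f\<in>borel_measurable M. (\<integral>\<^sup>+x\<in>A. f x \<partial>M) \<le> ennreal C * N f))"

definition bfs :: "'a measure \<Rightarrow> (('a \<Rightarrow> ennreal) \<Rightarrow> ennreal) \<Rightarrow> ('a \<Rightarrow> real) set" where
  "bfs M N = {f \<in> borel_measurable M. N (\<lambda>x. ennreal \<bar>f x\<bar>) < \<infinity>}"

definition Linfty :: "'a measure \<Rightarrow> ('a \<Rightarrow> real) set" where
  "Linfty M = {f \<in> borel_measurable M. \<exists>K. AE x in M. \<bar>f x\<bar> \<le> K}"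

definition rearr :: "'a measure \<Rightarrow> ('a \<Rightarrow> ennreal) \<Rightarrow> real \<Rightarrow> ennreal" where
  "rearr M f s = Inf {t. emeasure M {x \<in> space M. t < f x} \<le> ennreal s}"

text \<open>\<open>N g < \<infinity>\<close> says that \<open>g\<close> belongs to the space; that \<open>f\<close> does too is part of \<open>N f \<le> N g\<close>.\<close>

definition ri_space :: "'a measure \<Rightarrow> (('a \<Rightarrow> ennreal) \<Rightarrow> ennreal) \<Rightarrow> bool" where
  "ri_space M N \<longleftrightarrow>
     banach_function_norm M N \<and>
     (\<forall>f\<in>borel_measurable M. \<forall>g\<in>borel_measurable M.
        N g < \<infinity> \<and> (AE s in lborel. 0 \<le> s \<longrightarrow> rearr M f s \<le> rearr M g s) \<longrightarrow> N f \<le> N g)"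

text \<open>In an r.i. space this does not depend on the chosen set. On an RD-space every \<open>t \<ge> 0\<close> is
  the measure of some set, since the measure is atomless and has infinite total mass.\<close>

definition fundamental_function ::
    "'a measure \<Rightarrow> (('a \<Rightarrow> ennreal) \<Rightarrow> ennreal) \<Rightarrow> real \<Rightarrow> ennreal" where
  "fundamental_function M N t = N (indicator (SOME F. F \<in> sets M \<and> emeasure M F = ennreal t))"

definition E_X ::
    "'a::metric_space measure \<Rightarrow> (('a \<Rightarrow> ennreal) \<Rightarrow> ennreal) \<Rightarrow> ('a \<Rightarrow> real) \<Rightarrow> real \<Rightarrow> ennreal" where
  "E_X M N f t =
     N (\<lambda>x. (\<integral>\<^sup>+y\<in>ball x t. ennreal \<bar>f x - f y\<bar> \<partial>M) / emeasure M (ball x t))"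

definition essentially_continuous :: "'a::topological_space measure \<Rightarrow> ('a \<Rightarrow> real) \<Rightarrow> bool" where
  "essentially_continuous M f \<longleftrightarrow> (\<exists>g. continuous_on UNIV g \<and> (AE x in M. f x = g x))"

end

theory Submission
  imports Defs
begin

text \<open>
  Write \<open>g\<^sub>t\<close> for the mean oscillation of \<open>f\<close> at scale \<open>t\<close>, so that \<open>E_X M N f t = N g\<^sub>t\<close>.
  No differentiation theorem and no averaging operator is needed. The weak type estimate
  \<open>\<mu> {g > 2 N g / \<phi> v} < v\<close>, with \<open>v\<close> a quarter of the lower bound of the measure of a ball
  given by the non-collapsing property, shows that most points of \<open>B(x, r)\<close> have
  oscillation at scale \<open>4r\<close> at most \<open>2 E_X(f, 4r) / \<phi> v\<close>. By Markov's inequality such a point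
  \<open>z\<close> satisfies \<open>|f z - f u| \<preceq> E_X(f, 4r) / \<phi> v\<close> for most \<open>u\<close> in any ball of comparable size
  contained in \<open>B(z, 4r)\<close>. Hence one can choose a chain of points through the balls
  \<open>B(x, R/2\<^sup>j)\<close>, and another one around \<open>y\<close>, whose increments are controlled by a dyadic sum
  comparable to the integral. If that sum is finite, then \<open>N g\<^sub>t \<rightarrow> 0\<close> along the dyadic scales,
  so by Fatou \<open>liminf g\<^sub>t = 0\<close> almost everywhere, and the chains can be started at
  almost every point.
\<close>

section \<open>Markov's inequality, dyadic scales and tails of series\<close>

text \<open>Markov's inequality at four times the mean bound. The strict inequality in the set keeps
  the degenerate cases true: for \<open>l = 0\<close> the function vanishes almost everywhere on
  \<open>B\<close>, and for infinite \<open>l\<close> the set is empty. The fraction one quarter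
  lets three exceptional sets be discarded from a ball at once.\<close>

lemma markov_quarter:
  fixes u :: "'a \<Rightarrow> ennreal"
  assumes [measurable]: "u \<in> borel_measurable M" "B \<in> sets M"
    and le: "(\<integral>\<^sup>+w\<in>B. u w \<partial>M) \<le> l * emeasure M B"
  shows "4 * emeasure M {w\<in>B. 4 * l < u w} \<le> emeasure M B"
proof -
  have [measurable]: "{w\<in>B. 4 * l < u w} \<in> sets M"
    using sets.sets_into_space[OF assms(2)] by measurable
  consider "l = 0" | "l = \<infinity>" | "l \<noteq> 0" "l \<noteq> \<infinity>" by blast
  then show ?thesis
  proof cases
    case 1
    then have "AE w in M. u w * indicator B w = 0"
      using le by (subst (asm) 1) (simp add: nn_integral_0_iff_AE)
    then have "AE w in M. w \<notin> {w\<in>B. 4 * l < u w}"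
      using 1 by (auto simp: indicator_def)
    then have "emeasure M {w\<in>B. 4 * l < u w} = 0"
      using AE_iff_null_sets[of "{w\<in>B. 4 * l < u w}" M] by (auto dest: null_setsD1)
    then show ?thesis by simp
  next
    case 2
    then show ?thesis by (simp add: ennreal_mult_top)
  next
    case 3
    have "4 * l * emeasure M {w\<in>B. 4 * l < u w} = (\<integral>\<^sup>+w. 4 * l * indicator {w\<in>B. 4 * l < u w} w \<partial>M)"
      by (simp add: nn_integral_cmult_indicator)
    also have "\<dots> \<le> (\<integral>\<^sup>+w\<in>B. u w \<partial>M)"
      by (intro nn_integral_mono) (auto simp: indicator_def)
    also note le
    finally have "l * (4 * emeasure M {w\<in>B. 4 * l < u w}) \<le> l * emeasure M B"
      by (simp add: ac_simps)
    then show ?thesis using 3 by (simp add: ennreal_mult_le_mult_iff top_neq_ennreal)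
  qed
qed

lemma abs_triangle_ennreal: "ennreal \<bar>a - c\<bar> \<le> ennreal \<bar>a - b\<bar> + ennreal \<bar>b - c\<bar>"
  by (simp add: ennreal_leI flip: ennreal_plus)

lemma dyadic_scale:
  fixes R t :: real
  assumes "0 < t" "t < R"
  shows "\<exists>j. R / 2 ^ j \<le> t \<and> t \<le> 2 * (R / 2 ^ j)"
proof -
  have ex: "\<exists>j. R / 2 ^ j \<le> t"
  proof -
    obtain j where "R / t < 2 ^ j" using real_arch_pow[of 2] by auto
    then show ?thesis using assms by (intro exI[of _ j]) (auto simp: field_simps)
  qed
  \<comment> \<open>The least admissible index is not zero because \<open>t < R\<close>, so the
    preceding, twice larger scale still exceeds \<open>t\<close>.\<close>
  define j where "j = (LEAST j. R / 2 ^ j \<le> t)"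
  have j: "R / 2 ^ j \<le> t" using LeastI_ex[OF ex] by (simp add: j_def)
  have "j \<noteq> 0" using j assms by (intro notI) simp
  then obtain i where i: "j = Suc i" using not0_implies_Suc by blast
  then have "\<not> R / 2 ^ i \<le> t" using not_less_Least[of i "\<lambda>j. R / 2 ^ j \<le> t"] by (simp add: j_def)
  then show ?thesis using j i by (intro exI[of _ j]) auto
qed

lemma ennreal_suminf_tail_tendsto_0:
  fixes a :: "nat \<Rightarrow> ennreal"
  assumes "(\<Sum>j. a j) < \<infinity>"
  shows "(\<lambda>i. \<Sum>j. a (j + i)) \<longlonglongrightarrow> 0"
proof -
  have "a j < \<infinity>" for j
    using sum_le_suminf[of a "{j}"] assms by (auto intro: le_less_trans)
  then have a: "a j = ennreal (enn2real (a j))" for j by (simp add: less_top)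
  have s: "summable (\<lambda>j. enn2real (a j))"
    using assms a by (intro summable_suminf_not_top) auto
  have "(\<Sum>j. a (j + i)) = ennreal (\<Sum>j. enn2real (a (j + i)))" for i
  proof -
    have "(\<Sum>j. a (j + i)) = (\<Sum>j. ennreal (enn2real (a (j + i))))" using a by simp
    also have "\<dots> = ennreal (\<Sum>j. enn2real (a (j + i)))"
      by (intro suminf_ennreal2 summable_ignore_initial_segment s) simp
    finally show ?thesis .
  qed
  moreover have "(\<lambda>i. ennreal (\<Sum>j. enn2real (a (j + i)))) \<longlonglongrightarrow> ennreal 0"
    by (intro tendsto_ennrealI suminf_exist_split2 s)
  ultimately show ?thesis by simp
qed

section \<open>Volume growth of balls and separability\<close>

text \<open>Fixing the constants of the growth conditions and of non-collapsing here makes every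
  later constant depend on them alone, and never on \<open>f\<close> or on points. The inequalities
  are between reals, which is possible because balls have finite measure.\<close>

locale rd_measure =
  fixes M :: "'a::metric_space measure" and k n C1 C2 m0 :: real
  assumes borel_sets: "sets borel \<subseteq> sets M"
    and ball_finite: "\<And>x r. emeasure M (ball x r) < \<infinity>"
    and k_pos: "0 < k" and k_le_n: "k \<le> n" and C1_pos: "0 < C1" and C1_le: "C1 \<le> 1"
    and C2_ge: "1 \<le> C2"
    and lower: "\<And>x r l. 0 < r \<Longrightarrow> 1 \<le> l \<Longrightarrow>
      C1 * l powr k * measure M (ball x r) \<le> measure M (ball x (l * r))"
    and upper: "\<And>x r l. 0 < r \<Longrightarrow> 1 \<le> l \<Longrightarrow>
      measure M (ball x (l * r)) \<le> C2 * l powr n * measure M (ball x r)"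
    and m0_pos: "0 < m0" and m0_le: "\<And>x. m0 \<le> measure M (ball x 1)"
begin

definition rho :: "real \<Rightarrow> real" where
  "rho r = min (r powr k) (r powr n)"

definition c0 :: real where
  "c0 = m0 * C1 / C2"

lemma space_UNIV [simp]: "space M = UNIV"
  using borel_sets sets.sets_into_space[of UNIV M] by (metis UNIV_I UNIV_eq_I borel_open open_UNIV subsetD)

lemma ball_in_sets [measurable, simp]: "ball x r \<in> sets M"
  using borel_sets by auto

lemma ball_emeasure: "emeasure M (ball x r) = ennreal (measure M (ball x r))"
  using ball_finite[of x r] by (simp add: emeasure_eq_ennreal_measure less_top)

lemma measure_ball_mono: "ball x r \<subseteq> ball y s \<Longrightarrow> measure M (ball x r) \<le> measure M (ball y s)"
  using ball_finite[of y s] by (intro measure_mono_fmeasurable) (auto simp: fmeasurable_def)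

lemma c0_pos: "0 < c0"
  using m0_pos C1_pos C2_ge by (simp add: c0_def)

lemma rho_pos: "0 < r \<Longrightarrow> 0 < rho r"
  by (simp add: rho_def)

lemma rho_mono: "0 < r \<Longrightarrow> r \<le> s \<Longrightarrow> rho r \<le> rho s"
  unfolding rho_def using k_pos k_le_n by (intro min.mono powr_mono2) auto

lemma rho_scale:
  assumes "0 < r" shows "rho (8 * r) \<le> 8 powr n * rho r"
proof -
  have "(8::real) powr k \<le> 8 powr n" using k_le_n by (intro powr_mono) auto
  then have "(8 * r) powr k \<le> 8 powr n * r powr k"
    using assms by (simp add: powr_mult)
  moreover have "(8 * r) powr n = 8 powr n * r powr n"
    using assms by (simp add: powr_mult)
  ultimately show ?thesis
    unfolding rho_def by (smt (verit))
qed

text \<open>Both growth conditions are compared with the unit ball: the lower one for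
  \<open>1 \<le> r\<close>, giving the constant \<open>m0 * C1\<close>, and the upper one for
  smaller \<open>r\<close>, giving \<open>m0 / C2\<close>. The constant \<open>c0\<close> is at most
  both, and \<open>rho r\<close> is at most both powers.\<close>

lemma ball_lower_bound:
  assumes "0 < r" shows "c0 * rho r \<le> measure M (ball x r)"
proof (cases "1 \<le> r")
  case True
  have "c0 * rho r \<le> (m0 * C1) * r powr k"
    unfolding c0_def rho_def using C2_ge mult_pos_pos[OF m0_pos C1_pos]
    by (intro mult_mono) (auto simp: divide_le_eq mult_le_cancel_left1 simp del: mult_less_0_iff zero_less_mult_iff)
  also have "\<dots> \<le> C1 * r powr k * measure M (ball x 1)"
    using mult_left_mono[OF m0_le[of x], of "C1 * r powr k"] C1_pos by (simp add: algebra_simps)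
  also have "\<dots> \<le> measure M (ball x r)"
    using lower[of 1 r x] True by simp
  finally show ?thesis .
next
  case False
  have "m0 \<le> C2 * (1 / r) powr n * measure M (ball x r)"
    using upper[of r "1/r" x] m0_le[of x] False assms by simp
  then have "m0 / C2 * r powr n \<le> measure M (ball x r)"
    using C2_ge assms by (simp add: powr_divide field_simps)
  moreover have "c0 * rho r \<le> m0 / C2 * r powr n"
    unfolding c0_def rho_def using m0_pos C1_pos C1_le C2_ge
    by (intro mult_mono) (auto simp: divide_right_mono mult_left_le)
  ultimately show ?thesis by simp
qed

lemma ball_pos: "0 < r \<Longrightarrow> 0 < measure M (ball x r)"
  using ball_lower_bound[of r x] c0_pos rho_pos[of r] by (smt (verit) mult_pos_pos)

text \<open>A separated set of maximal cardinality; the balls around its points are disjoint and have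
  measure bounded below.\<close>

lemma separated_finite_cover:
  fixes x0 :: 'a
  assumes "0 < e"
  shows "\<exists>S. finite S \<and> (\<forall>x\<in>ball x0 R. \<exists>q\<in>S. dist x q < e)"
proof -
  define P where "P S \<longleftrightarrow> finite S \<and> S \<subseteq> ball x0 R \<and> (\<forall>p\<in>S. \<forall>q\<in>S. p \<noteq> q \<longrightarrow> e \<le> dist p q)" for S
  define a where "a = c0 * rho (e/2)"
  have a: "0 < a" using c0_pos rho_pos assms by (simp add: a_def)
  have bound: "real (card S) \<le> measure M (ball x0 (R + e)) / a" if "P S" for S
  proof -
    have "real (card S) * a \<le> (\<Sum>p\<in>S. measure M (ball p (e/2)))"
      using ball_lower_bound[of "e/2"] assms by (intro sum_bounded_below) (auto simp: a_def)
    also have "\<dots> = measure M (\<Union>p\<in>S. ball p (e/2))"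
    proof (intro measure_finite_Union[symmetric])
      show "disjoint_family_on (\<lambda>p. ball p (e/2)) S"
        unfolding disjoint_family_on_def
      proof (intro ballI impI equals0I)
        fix p q z assume "p \<in> S" "q \<in> S" "p \<noteq> q" "z \<in> ball p (e/2) \<inter> ball q (e/2)"
        then have "e \<le> dist p q" "dist p z < e/2" "dist q z < e/2"
          using that by (auto simp: P_def)
        then show False using dist_triangle2[of p q z] by simp
      qed
    qed (use that ball_finite in \<open>auto simp: P_def less_top\<close>)
    also have "\<dots> \<le> measure M (ball x0 (R + e))"
    proof (intro measure_mono_fmeasurable)
      show "(\<Union>p\<in>S. ball p (e/2)) \<subseteq> ball x0 (R + e)"
      proof safe
        fix p z assume "p \<in> S" "z \<in> ball p (e/2)"
        then have "dist x0 p < R" "dist p z < e/2" using that by (auto simp: P_def)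
        then show "z \<in> ball x0 (R + e)" using dist_triangle[of x0 z p] assms by simp
      qed
    qed (use that ball_finite in \<open>auto simp: P_def fmeasurable_def\<close>)
    finally show ?thesis using a by (simp add: field_simps)
  qed
  have "P {}" by (simp add: P_def)
  moreover have "\<forall>S. P S \<longrightarrow> card S < Suc (nat \<lfloor>measure M (ball x0 (R + e)) / a\<rfloor>)"
    using bound by (auto simp: le_nat_floor less_Suc_eq_le)
  ultimately obtain S where S: "P S" and max: "\<And>T. P T \<Longrightarrow> card T \<le> card S"
    using ex_has_greatest_nat[of P "{}" card] by blast
  have "\<exists>q\<in>S. dist x q < e" if "x \<in> ball x0 R" for x
  proof (rule ccontr)
    assume "\<not> ?thesis"
    then have far: "\<And>q. q \<in> S \<Longrightarrow> e \<le> dist x q" by force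
    then have "x \<notin> S" using assms by fastforce
    moreover have "P (insert x S)"
      using S that far by (auto simp: P_def dist_commute)
    ultimately show False using max[of "insert x S"] S by (auto simp: P_def)
  qed
  then show ?thesis using S by (auto simp: P_def)
qed

text \<open>Finite nets of mesh \<open>1 / real (Suc j)\<close> in the balls of integer radius
  around one point are collected. The countable dense set serves twice: for measurability in the
  product space and for countable covers by small balls.\<close>

lemma separable: "\<exists>D :: 'a set. countable D \<and> (\<forall>x. \<forall>e>0. \<exists>q\<in>D. dist x q < e)"
proof -
  obtain x0 :: 'a where True by blast
  have "\<forall>i::nat. \<forall>j::nat. \<exists>S. finite S \<and> (\<forall>x\<in>ball x0 (real i). \<exists>q\<in>S. dist x q < 1 / real (Suc j))"
    using separated_finite_cover by simp
  then obtain S where S: "\<And>i j. finite (S i j)"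
    "\<And>i j x. x \<in> ball x0 (real i) \<Longrightarrow> \<exists>q\<in>S i j. dist x q < 1 / real (Suc j)"
    by metis
  show ?thesis
  proof (intro exI conjI allI impI)
    show "countable (\<Union>i j. S i j)"
      using S(1) by (intro countable_UN) (auto intro: countable_finite)
    fix x :: 'a and e :: real assume "0 < e"
    then obtain j where j: "1 / real (Suc j) < e" using nat_approx_posE by blast
    obtain i where "dist x0 x < real i" using reals_Archimedean2 by blast
    then obtain q where "q \<in> S i j" "dist x q < 1 / real (Suc j)" using S(2)[of x i j] by auto
    then show "\<exists>q\<in>\<Union>i j. S i j. dist x q < e" using j by force
  qed
qed

lemma UN_ball_UNIV: "(\<Union>i::nat. ball x (real i)) = UNIV"
  using reals_Archimedean2 by auto

sublocale sigma_finite_measure M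
proof
  obtain x0 :: 'a where True by blast
  show "\<exists>A. countable A \<and> A \<subseteq> sets M \<and> \<Union> A = space M \<and> (\<forall>a\<in>A. emeasure M a \<noteq> \<infinity>)"
    using ball_finite UN_ball_UNIV[of x0]
    by (intro exI[of _ "range (\<lambda>i::nat. ball x0 (real i))"]) (auto simp: less_top)
qed

text \<open>In a metric space that is not separable the distance may fail to be measurable for the
  product sigma-algebra. Here the strip around the diagonal is a countable union of rectangles of
  balls, with centres in the dense set and rational radii.\<close>

lemma near_diagonal_sets: "{(x, y). dist x y < t} \<in> sets (M \<Otimes>\<^sub>M M)"
proof -
  obtain D :: "'a set" where D: "countable D" "\<And>x e. 0 < e \<Longrightarrow> \<exists>q\<in>D. dist x q < e"
    using separable by metis
  have "{(x, y). dist x y < t} =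
    (\<Union>q\<in>D. \<Union>r\<in>\<rat>. ball q r \<times> ball q (t - r))" (is "?L = ?R")
  proof
    show "?R \<subseteq> ?L"
      using dist_triangle_less_add by (fastforce simp: dist_commute)
    show "?L \<subseteq> ?R"
    proof clarify
      fix x y :: 'a assume "dist x y < t"
      then obtain q where q: "q \<in> D" "dist x q < (t - dist x y) / 2"
        using D(2)[of "(t - dist x y)/2" x] by auto
      have "dist q y \<le> dist x q + dist x y"
        using dist_triangle[of q y x] by (simp add: dist_commute)
      then have "dist x q < t - dist q y" using q by (simp add: field_simps)
      then obtain r where "r \<in> \<rat>" "dist x q < r" "r < t - dist q y"
        using Rats_dense_in_real by blast
      then show "(x, y) \<in> ?R" using q by (force simp: dist_commute)
    qed
  qed
  also have "\<dots> \<in> sets (M \<Otimes>\<^sub>M M)"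
    using D(1) by (intro sets.countable_UN'' countable_rat pair_measureI ball_in_sets)
  finally show ?thesis .
qed

section \<open>Measurability and doubling of the mean oscillation\<close>

definition mosc :: "('a \<Rightarrow> real) \<Rightarrow> real \<Rightarrow> 'a \<Rightarrow> ennreal" where
  "mosc f t x = (\<integral>\<^sup>+y\<in>ball x t. ennreal \<bar>f x - f y\<bar> \<partial>M) / emeasure M (ball x t)"

text \<open>Numerator and denominator are rewritten as integrals over \<open>y\<close> of jointly
  measurable functions of \<open>(x, y)\<close>; by sigma-finiteness such integrals are measurable
  in \<open>x\<close>.\<close>

lemma mosc_measurable [measurable]:
  assumes [measurable]: "f \<in> borel_measurable M"
  shows "mosc f t \<in> borel_measurable M"
proof -
  have [measurable]: "Measurable.pred (M \<Otimes>\<^sub>M M) (\<lambda>(x, y). dist x y < t)"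
    using near_diagonal_sets by (simp add: pred_def space_pair_measure split_beta')
  have "mosc f t = (\<lambda>x. (\<integral>\<^sup>+y. ennreal \<bar>f x - f y\<bar> * indicator {z. case z of (x, y) \<Rightarrow> dist x y < t} (x, y) \<partial>M)
     / (\<integral>\<^sup>+y. indicator {z. case z of (x, y) \<Rightarrow> dist x y < t} (x, y) \<partial>M))"
  proof
    fix x :: 'a
    have "indicator {z. case z of (x, y) \<Rightarrow> dist x y < t} (x, y) = (indicator (ball x t) y :: ennreal)" for y
      by (simp add: indicator_def)
    then show "mosc f t x = (\<integral>\<^sup>+y. ennreal \<bar>f x - f y\<bar> * indicator {z. case z of (x, y) \<Rightarrow> dist x y < t} (x, y) \<partial>M)
     / (\<integral>\<^sup>+y. indicator {z. case z of (x, y) \<Rightarrow> dist x y < t} (x, y) \<partial>M)"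
      by (simp add: mosc_def)
  qed
  also have "\<dots> \<in> borel_measurable M" 
    using near_diagonal_sets[of t] by measurable
  finally show ?thesis .
qed

text \<open>Enlarging the ball increases the integral, while the measure in the denominator grows at
  most by the doubling factor.\<close>

lemma mosc_doubling:
  assumes "0 < t" "t \<le> s" "s \<le> 2 * t"
  shows "mosc f t x \<le> ennreal (C2 * 2 powr n) * mosc f s x"
proof -
  let ?I = "\<lambda>t. \<integral>\<^sup>+y\<in>ball x t. ennreal \<bar>f x - f y\<bar> \<partial>M"
  let ?m = "\<lambda>t. measure M (ball x t)"
  have "?m s \<le> ?m (2 * t)" using assms by (intro measure_ball_mono) auto
  also have "\<dots> \<le> C2 * 2 powr n * ?m t" using upper[of t 2] assms by simp
  finally have m: "?m s \<le> C2 * 2 powr n * ?m t" .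
  have "?I t \<le> ?I s"
    using assms by (intro nn_integral_mono) (auto simp: indicator_def)
  then have "mosc f t x \<le> ?I s / ennreal (?m t)"
    by (simp add: mosc_def ball_emeasure divide_right_mono_ennreal)
  also have "\<dots> = ?I s * ennreal (1 / ?m t)"
    using ball_pos[of t] assms by (simp add: divide_ennreal_def inverse_ennreal inverse_eq_divide)
  also have "\<dots> \<le> ?I s * ennreal (C2 * 2 powr n * (1 / ?m s))"
    using m ball_pos[of t x] ball_pos[of s x] assms
    by (intro mult_left_mono ennreal_leI) (auto simp: field_simps)
  also have "\<dots> = ennreal (C2 * 2 powr n) * mosc f s x"
    using ball_pos[of s x] assms C2_ge
    by (subst ennreal_mult)
      (auto simp: mosc_def ball_emeasure divide_ennreal_def inverse_ennreal inverse_eq_divide ac_simps)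
  finally show ?thesis .
qed

section \<open>Small balls and sets of prescribed measure\<close>

lemma powr_unbounded: "\<exists>l\<ge>1. b \<le> C1 * l powr k"
proof -
  define a where "a = max b 0 / C1"
  have a: "0 \<le> a" "b \<le> C1 * a" using C1_pos by (auto simp: a_def)
  have "a = (a powr (1/k)) powr k" using a k_pos by (simp add: powr_powr)
  also have "\<dots> \<le> (max 1 (a powr (1/k))) powr k" using k_pos by (intro powr_mono2) auto
  finally have "C1 * a \<le> C1 * (max 1 (a powr (1/k))) powr k" using C1_pos by simp
  then show ?thesis using a by (intro exI[of _ "max 1 (a powr (1/k))"]) auto
qed

lemma small_ball:
  assumes "0 < e" shows "\<exists>r>0. measure M (ball x r) \<le> e"
proof -
  obtain l where l: "1 \<le> l" "measure M (ball x 1) / e \<le> C1 * l powr k" using powr_unbounded by blast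
  have "C1 * l powr k * measure M (ball x (1/l)) \<le> measure M (ball x 1)"
    using lower[of "1/l" l x] l(1) by simp
  also have "\<dots> \<le> C1 * l powr k * e" using l(2) assms by (simp add: field_simps)
  finally have "measure M (ball x (1/l)) \<le> e"
    using C1_pos l(1) by (simp add: mult_le_cancel_left)
  then show ?thesis using l(1) by (intro exI[of _ "1/l"]) auto
qed

lemma large_ball: "\<exists>r>0. t \<le> measure M (ball x r)"
proof -
  obtain l where l: "1 \<le> l" "t / m0 \<le> C1 * l powr k" using powr_unbounded by blast
  have "t \<le> C1 * l powr k * m0" using l(2) m0_pos by (simp add: field_simps)
  also have "\<dots> \<le> C1 * l powr k * measure M (ball x 1)"
    using m0_le C1_pos by (intro mult_left_mono) auto
  also have "\<dots> \<le> measure M (ball x l)" using lower[of 1 l x] l(1) by simp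
  finally show ?thesis using l(1) by (intro exI[of _ l]) auto
qed

lemma small_cover:
  assumes "0 < e"
  shows "\<exists>U::nat \<Rightarrow> 'a set. (\<forall>i. U i \<in> sets M \<and> emeasure M (U i) \<le> ennreal e) \<and> (\<Union>i. U i) = UNIV"
proof -
  obtain D :: "'a set" where D: "countable D" "\<And>x e. 0 < e \<Longrightarrow> \<exists>q\<in>D. dist x q < e"
    using separable by metis
  \<comment> \<open>The radius below which balls have measure at most \<open>e\<close> may depend on
    the centre, so all sufficiently small members of one countable family are taken. The empty set
    is added so that \<open>from_nat_into\<close> has a nonempty set to enumerate.\<close>
  define F where "F = insert {} ((\<lambda>(q, j::nat). ball q (1 / real (Suc j))) ` (D \<times> UNIV) \<inter> {B. emeasure M B \<le> ennreal e})"
  have F: "countable F" "F \<noteq> {}"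
    using D(1) by (auto simp: F_def)
  have U: "B \<in> sets M \<and> emeasure M B \<le> ennreal e" if "B \<in> F" for B
    using that by (auto simp: F_def)
  have "x \<in> \<Union>F" for x
  proof -
    obtain r where r: "0 < r" "measure M (ball x r) \<le> e" using small_ball assms by blast
    obtain j where j: "1 / real (Suc j) < r / 2" using nat_approx_posE[of "r/2"] r by auto
    obtain q where q: "q \<in> D" "dist x q < 1 / real (Suc j)" using D(2)[of "1 / real (Suc j)" x] by auto
    have "ball q (1 / real (Suc j)) \<subseteq> ball x r"
    proof
      fix z assume "z \<in> ball q (1 / real (Suc j))"
      then show "z \<in> ball x r" using q j dist_triangle[of x z q] by simp
    qed
    then have "emeasure M (ball q (1 / real (Suc j))) \<le> emeasure M (ball x r)"
      by (intro emeasure_mono) auto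
    also have "\<dots> \<le> ennreal e" using r by (simp add: ball_emeasure ennreal_leI)
    finally have "ball q (1 / real (Suc j)) \<in> F" using q by (auto simp: F_def)
    then show ?thesis using q by (intro UnionI) (auto simp: dist_commute)
  qed
  then show ?thesis
    using U F by (intro exI[of _ "from_nat_into F"]) (auto simp: from_nat_into range_from_nat_into)
qed

text \<open>The pieces \<open>A \<inter> U j\<close> are added to \<open>C\<close> one by one. Each
  contributes at most \<open>e\<close>, so the last union before the measure exceeds
  \<open>t\<close> is within \<open>e\<close> of it; if it never exceeds \<open>t\<close>, then
  \<open>A\<close> itself serves. Starting from a given \<open>C\<close> allows the construction to
  be iterated increasingly.\<close>

lemma intermediate_measure_approx:
  assumes C: "C \<in> sets M" "C \<subseteq> A" "emeasure M C \<le> ennreal t"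
    and A: "A \<in> sets M" "ennreal t \<le> emeasure M A" and "0 < e"
  shows "\<exists>B\<in>sets M. C \<subseteq> B \<and> B \<subseteq> A \<and> emeasure M B \<le> ennreal t \<and> ennreal t \<le> emeasure M B + ennreal e"
proof -
  obtain U :: "nat \<Rightarrow> 'a set" where U: "\<And>i. U i \<in> sets M" "\<And>i. emeasure M (U i) \<le> ennreal e" "(\<Union>i. U i) = UNIV"
    using small_cover[OF \<open>0 < e\<close>] by blast
  define V where "V i = C \<union> (A \<inter> (\<Union>j<i. U j))" for i
  have V: "V i \<in> sets M" for i unfolding V_def using C A U by auto
  have VA: "V i \<subseteq> A" "C \<subseteq> V i" for i using C by (auto simp: V_def)
  show ?thesis
  proof (cases "\<exists>i. ennreal t < emeasure M (V i)")
    case True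
    define i where "i = (LEAST i. ennreal t < emeasure M (V i))"
    have i: "ennreal t < emeasure M (V i)" using LeastI_ex[OF True] by (simp add: i_def)
    have "i \<noteq> 0"
    proof
      assume "i = 0"
      then show False using i C(3) by (simp add: V_def)
    qed
    then obtain j where j: "i = Suc j" using not0_implies_Suc by blast
    have le: "emeasure M (V j) \<le> ennreal t"
      using not_less_Least[of j "\<lambda>i. ennreal t < emeasure M (V i)"] j by (auto simp: i_def)
    have "emeasure M (V i) \<le> emeasure M (V j \<union> U j)"
      using V U by (intro emeasure_mono) (auto simp: V_def j less_Suc_eq)
    also have "\<dots> \<le> emeasure M (V j) + emeasure M (U j)"
      using V U by (intro emeasure_subadditive) auto
    also have "\<dots> \<le> emeasure M (V j) + ennreal e" using U(2) by (intro add_left_mono) auto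
    finally have "ennreal t \<le> emeasure M (V j) + ennreal e" using i by simp
    then show ?thesis using le V VA by blast
  next
    case False
    have "A = (\<Union>i. V i)"
    proof
      show "A \<subseteq> (\<Union>i. V i)"
      proof
        fix x assume "x \<in> A"
        moreover obtain j where "x \<in> U j" using U(3) by auto
        ultimately have "x \<in> V (Suc j)" by (auto simp: V_def)
        then show "x \<in> (\<Union>i. V i)" by blast
      qed
    qed (use VA in auto)
    moreover have "incseq V" unfolding V_def incseq_def
      by (intro allI impI Un_mono Int_mono UN_mono order.refl) auto
    ultimately have "emeasure M A = (SUP i. emeasure M (V i))"
      using V by (simp add: SUP_emeasure_incseq image_subset_iff)
    also have "\<dots> \<le> ennreal t" using False by (intro SUP_least) (auto simp: not_less)
    finally show ?thesis using A C by (intro bexI[of _ A]) (auto simp: add_increasing2)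
  qed
qed

text \<open>There are no atoms, because the lower growth condition makes small balls have small measure.\<close>

lemma intermediate_measure:
  assumes "A \<in> sets M" "ennreal t \<le> emeasure M A"
  shows "\<exists>B\<in>sets M. B \<subseteq> A \<and> emeasure M B = ennreal t"
proof -
  define P where "P B \<longleftrightarrow> B \<in> sets M \<and> B \<subseteq> A \<and> emeasure M B \<le> ennreal t" for B
  \<comment> \<open>An increasing sequence of approximations with errors
    \<open>1 / real (Suc i)\<close>; continuity from below makes its union exact.\<close>
  have "\<exists>B. \<forall>i::nat. P (B i) \<and> (B i \<subseteq> B (Suc i) \<and> ennreal t \<le> emeasure M (B (Suc i)) + ennreal (1 / real (Suc i)))"
  proof (rule dependent_nat_choice)
    show "\<exists>B. P B" by (rule exI[of _ "{}"]) (simp add: P_def)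
    fix C and i :: nat assume "P C"
    then show "\<exists>B. P B \<and> C \<subseteq> B \<and> ennreal t \<le> emeasure M B + ennreal (1 / real (Suc i))"
      using intermediate_measure_approx[of C A t "1 / real (Suc i)"] assms by (auto simp: P_def)
  qed
  then obtain B :: "nat \<Rightarrow> 'a set" where B: "\<And>i. P (B i)" "\<And>i. B i \<subseteq> B (Suc i)"
    "\<And>i. ennreal t \<le> emeasure M (B (Suc i)) + ennreal (1 / real (Suc i))"
    by blast
  have sup: "(SUP i. emeasure M (B i)) = emeasure M (\<Union>i. B i)"
    using B by (intro SUP_emeasure_incseq incseq_SucI) (auto simp: P_def)
  have "emeasure M (\<Union>i. B i) \<le> ennreal t"
    unfolding sup[symmetric] using B by (intro SUP_least) (auto simp: P_def)
  moreover have "ennreal t \<le> emeasure M (\<Union>i. B i)"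
  proof (rule ennreal_le_epsilon)
    fix e :: real assume "0 < e"
    then obtain i where i: "1 / real (Suc i) < e" using nat_approx_posE by blast
    have "ennreal t \<le> emeasure M (B (Suc i)) + ennreal (1 / real (Suc i))" by (rule B)
    also have "\<dots> \<le> emeasure M (\<Union>i. B i) + ennreal e"
      using i B by (intro add_mono emeasure_mono ennreal_leI) (auto simp: P_def)
    finally show "ennreal t \<le> emeasure M (\<Union>i. B i) + ennreal e" .
  qed
  ultimately show ?thesis using B
    by (intro bexI[of _ "\<Union>i. B i"]) (auto simp: P_def intro!: antisym)
qed

text \<open>This makes the choice in \<open>fundamental_function\<close> meaningful at every
  argument: by the lower growth condition some ball has measure at least \<open>t\<close>, and a
  subset of it is exact.\<close>

lemma set_of_measure: "\<exists>F\<in>sets M. emeasure M F = ennreal t"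
proof -
  obtain x0 :: 'a where True by blast
  obtain r where "t \<le> measure M (ball x0 r)" using large_ball by blast
  then show ?thesis
    using intermediate_measure[of "ball x0 r" t] by (auto simp: ball_emeasure ennreal_leI)
qed

end

section \<open>The rearrangement invariant norm, its fundamental function and the weak type
  estimate\<close>

locale rd_ri = rd_measure M k n C1 C2 m0
  for M :: "'a::metric_space measure" and k n C1 C2 m0 +
  fixes N :: "('a \<Rightarrow> ennreal) \<Rightarrow> ennreal"
  assumes ri: "ri_space M N"
begin

lemma N_zero_iff: "f \<in> borel_measurable M \<Longrightarrow> N f = 0 \<longleftrightarrow> (AE x in M. f x = 0)"
  and N_scale: "f \<in> borel_measurable M \<Longrightarrow> 0 \<le> c \<Longrightarrow> N (\<lambda>x. ennreal c * f x) = ennreal c * N f"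
  and N_add: "f \<in> borel_measurable M \<Longrightarrow> g \<in> borel_measurable M \<Longrightarrow> N (\<lambda>x. f x + g x) \<le> N f + N g"
  and N_mono_AE: "f \<in> borel_measurable M \<Longrightarrow> g \<in> borel_measurable M \<Longrightarrow> (AE x in M. f x \<le> g x) \<Longrightarrow> N f \<le> N g"
  and N_indicator_finite: "A \<in> sets M \<Longrightarrow> emeasure M A < \<infinity> \<Longrightarrow> N (indicator A) < \<infinity>"
  and N_local: "A \<in> sets M \<Longrightarrow> emeasure M A < \<infinity> \<Longrightarrow>
        \<exists>C::real. \<forall>f\<in>borel_measurable M. (\<integral>\<^sup>+x\<in>A. f x \<partial>M) \<le> ennreal C * N f"
  using ri unfolding ri_space_def banach_function_norm_def by blast+

lemma N_mono: "f \<in> borel_measurable M \<Longrightarrow> g \<in> borel_measurable M \<Longrightarrow> (\<And>x. f x \<le> g x) \<Longrightarrow> N f \<le> N g"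
  by (intro N_mono_AE) auto

abbreviation "phi \<equiv> fundamental_function M N"

text \<open>The distribution function of an indicator is the measure of the set at levels below 1
  and zero from there on, so the set of smaller measure has the pointwise smaller
  rearrangement.\<close>

lemma N_indicator_mono:
  assumes [measurable]: "F \<in> sets M" "G \<in> sets M"
    and le: "emeasure M F \<le> emeasure M G" and fin: "emeasure M G < \<infinity>"
  shows "N (indicator F) \<le> N (indicator G)"
proof -
  have level: "emeasure M {x \<in> space M. t < (indicator A x :: ennreal)} = (if t < 1 then emeasure M A else 0)"
    for t :: ennreal and A
  proof -
    have "{x \<in> space M. t < (indicator A x :: ennreal)} = (if t < 1 then A else {})"
      by (auto simp: indicator_def)
    then show ?thesis by simp
  qed
  have "rearr M (indicator F) s \<le> rearr M (indicator G) s" for s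
    unfolding rearr_def level using le by (intro Inf_superset_mono) (auto split: if_splits)
  then show ?thesis
    using ri N_indicator_finite[OF assms(2) fin] unfolding ri_space_def by auto
qed

lemma phi_eq:
  assumes "F \<in> sets M" "emeasure M F = ennreal t"
  shows "phi t = N (indicator F)"
proof -
  define G where "G = (SOME F. F \<in> sets M \<and> emeasure M F = ennreal t)"
  have "G \<in> sets M \<and> emeasure M G = ennreal t"
    unfolding G_def using set_of_measure[of t] unfolding Bex_def by (rule someI_ex)
  then have "N (indicator G) = N (indicator F)"
    using assms by (intro antisym N_indicator_mono) auto
  then show ?thesis by (simp add: fundamental_function_def G_def)
qed

lemma phi_le:
  assumes "F \<in> sets M" "ennreal t \<le> emeasure M F" "emeasure M F < \<infinity>"
  shows "phi t \<le> N (indicator F)"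
proof -
  obtain G where "G \<in> sets M" "emeasure M G = ennreal t" using set_of_measure by blast
  then show ?thesis using assms by (simp add: phi_eq N_indicator_mono)
qed

lemma phi_mono: "s \<le> t \<Longrightarrow> phi s \<le> phi t"
  using set_of_measure[of t] phi_eq[of _ t] phi_le[of _ s] by (auto simp: ennreal_leI)

lemma phi_finite: "phi t < \<infinity>"
  using set_of_measure[of t] N_indicator_finite by (auto simp: phi_eq)

lemma phi_pos:
  assumes "0 < t" shows "0 < phi t"
proof -
  obtain F where F: "F \<in> sets M" "emeasure M F = ennreal t" using set_of_measure by blast
  have "N (indicator F) \<noteq> 0"
  proof
    assume "N (indicator F) = 0"
    then have "AE x in M. x \<notin> F" using F by (simp add: N_zero_iff indicator_eq_0_iff)
    then have "emeasure M F = 0" using F AE_iff_null_sets[of F M] by (auto dest: null_setsD1)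
    then show False using F assms by simp
  qed
  then show ?thesis using F by (simp add: phi_eq zero_less_iff_neq_zero)
qed

text \<open>A set of measure \<open>s + t\<close> splits into two pieces of measures
  \<open>s\<close> and \<open>t\<close>, and the triangle inequality applies to their indicators.
  Iterated, this compares \<open>phi\<close> at volumes that differ by a bounded factor.\<close>

lemma phi_add:
  assumes "0 \<le> s" "0 \<le> t" shows "phi (s + t) \<le> phi s + phi t"
proof -
  obtain F where F: "F \<in> sets M" "emeasure M F = ennreal (s + t)" using set_of_measure by blast
  obtain G where G: "G \<in> sets M" "G \<subseteq> F" "emeasure M G = ennreal s"
    using intermediate_measure[of F s] F assms by (auto simp: ennreal_leI)
  have "emeasure M (F - G) = ennreal t"
    using F G assms by (subst emeasure_Diff) (auto simp: ennreal_minus)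
  then have "phi t = N (indicator (F - G))" using F G by (intro phi_eq) auto
  moreover have "phi s = N (indicator G)" using G by (intro phi_eq) auto
  moreover have "phi (s + t) = N (indicator F)" using F by (intro phi_eq) auto
  moreover have "N (indicator F) = N (\<lambda>x. indicator G x + indicator (F - G) x)"
    using G by (intro arg_cong[of _ _ N] ext) (auto simp: indicator_def)
  ultimately show ?thesis using F G by (simp add: N_add)
qed

lemma phi_multiple:
  assumes "0 \<le> t" shows "phi (real (Suc m) * t) \<le> of_nat (Suc m) * phi t"
proof (induction m)
  case (Suc m)
  have "phi (real (Suc (Suc m)) * t) = phi (t + real (Suc m) * t)" by (simp add: algebra_simps)
  also have "\<dots> \<le> phi t + phi (real (Suc m) * t)" using assms by (intro phi_add) auto
  also have "\<dots> \<le> phi t + of_nat (Suc m) * phi t" using Suc by (intro add_left_mono)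
  finally show ?case by (simp add: algebra_simps)
qed simp

text \<open>If the level set had measure at least \<open>v\<close>, its indicator would have norm at
  least \<open>phi v\<close>; multiplied by the level it lies below \<open>g\<close>, whence
  \<open>2 * N g \<le> N g\<close>. This is absurd unless \<open>N g\<close> is zero or infinite. In
  the first case \<open>g\<close> vanishes almost everywhere, in the second the level is infinite
  and the set is empty.\<close>

lemma weak_type:
  assumes [measurable]: "g \<in> borel_measurable M" "S \<in> sets M"
    and "emeasure M S < \<infinity>" "0 < v"
  shows "emeasure M {x\<in>S. 2 * (N g / phi v) < g x} < ennreal v"
proof (rule ccontr)
  define A where "A = {x\<in>S. 2 * (N g / phi v) < g x}"
  have A [measurable]: "A \<in> sets M"
    unfolding A_def using sets.sets_into_space[OF assms(2)] by measurable
  assume "\<not> ?thesis"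
  then have v: "ennreal v \<le> emeasure M A" by (simp add: A_def)
  have "emeasure M A \<le> emeasure M S" by (intro emeasure_mono) (auto simp: A_def)
  then have "phi v \<le> N (indicator A)"
    using v assms by (intro phi_le) auto
  have phi: "phi v \<noteq> 0" "phi v \<noteq> \<infinity>" using phi_pos[of v] phi_finite[of v] assms by auto
  have "N g \<noteq> \<infinity>"
  proof
    assume "N g = \<infinity>"
    then have "A = {}" using phi by (auto simp: A_def ennreal_top_divide ennreal_mult_top)
    then show False using v assms by simp
  qed
  have "N g \<noteq> 0"
  proof
    assume "N g = 0"
    then have "AE x in M. g x = 0" by (simp add: N_zero_iff)
    then have "AE x in M. x \<notin> A" by eventually_elim (auto simp: A_def)
    then have "emeasure M A = 0" using AE_iff_null_sets[of A M] A by (auto dest: null_setsD1)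
    then show False using v assms by simp
  qed
  define l where "l = enn2real (2 * (N g / phi v))"
  have "2 * (N g / phi v) \<noteq> \<infinity>"
    using phi \<open>N g \<noteq> \<infinity>\<close> by (simp add: ennreal_mult_eq_top_iff ennreal_divide_eq_top_iff)
  then have l: "ennreal l = 2 * (N g / phi v)" by (simp add: l_def less_top)
  have "2 * N g = ennreal l * phi v"
    unfolding l mult.assoc ennreal_divide_times using phi by (simp add: ennreal_mult_divide_eq mult.commute divide_eq_1_ennreal less_top flip: ennreal_times_divide)
  also have "\<dots> \<le> ennreal l * N (indicator A)" by (intro mult_left_mono) (auto intro: \<open>phi v \<le> _\<close>)
  also have "\<dots> = N (\<lambda>x. ennreal l * indicator A x)" by (simp add: N_scale l_def)
  also have "\<dots> \<le> N g"
    by (intro N_mono) (auto simp: l A_def indicator_def)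
  finally have le: "2 * N g \<le> N g" .
  obtain r where r: "0 \<le> r" "N g = ennreal r" using \<open>N g \<noteq> \<infinity>\<close> by (cases "N g") auto
  have "2 * N g = ennreal (2 * r)" using r by (simp add: ennreal_mult)
  then have "r = 0" using le r by simp
  then show False using \<open>N g \<noteq> 0\<close> r by simp
qed

lemma E_X_eq: "E_X M N f t = N (mosc f t)"
  by (simp add: E_X_def mosc_def[abs_def])

lemma E_X_doubling:
  assumes "f \<in> borel_measurable M" "0 < t" "t \<le> s" "s \<le> 2 * t"
  shows "E_X M N f t \<le> ennreal (C2 * 2 powr n) * E_X M N f s"
proof -
  have "E_X M N f t \<le> N (\<lambda>x. ennreal (C2 * 2 powr n) * mosc f s x)"
    unfolding E_X_eq using assms mosc_doubling by (intro N_mono) auto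
  then show ?thesis using assms C2_ge by (simp add: N_scale E_X_eq)
qed

section \<open>Chains of good points through dyadic balls\<close>

definition vol :: "real \<Rightarrow> real" where
  "vol r = c0 * rho r / 4"

lemma vol_pos: "0 < r \<Longrightarrow> 0 < vol r"
  using c0_pos rho_pos by (simp add: vol_def)

lemma vol_le:
  assumes "0 < r" shows "4 * ennreal (vol r) \<le> emeasure M (ball x r)"
proof -
  have "4 * ennreal (vol r) = ennreal (4 * vol r)"
    using vol_pos[OF assms] by (simp add: ennreal_mult)
  also have "\<dots> \<le> emeasure M (ball x r)"
    using ball_lower_bound[OF assms, of x] by (simp add: ball_emeasure vol_def ennreal_leI)
  finally show ?thesis .
qed

text \<open>Twice this value is the level of the weak type estimate at volume \<open>vol r\<close>.
  The scale \<open>4 * r\<close> leaves room for points at distance less than \<open>3 * r\<close>,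
  the largest that occurs between a chain point and a point of the ball where the next one is
  sought.\<close>

definition nu :: "('a \<Rightarrow> real) \<Rightarrow> real \<Rightarrow> ennreal" where
  "nu f r = E_X M N f (4 * r) / phi (vol r)"

definition good :: "('a \<Rightarrow> real) \<Rightarrow> real \<Rightarrow> 'a \<Rightarrow> bool" where
  "good f r z \<longleftrightarrow> mosc f (4 * r) z \<le> 2 * nu f r"

text \<open>The factor 4 is the one in \<open>markov_quarter\<close>; \<open>C2 * 8 powr n\<close>
  compares the measures of balls whose radii differ by the factor 8.\<close>

definition K :: real where
  "K = 4 * (C2 * 8 powr n)"

lemma K_pos: "0 < K" using C2_ge by (simp add: K_def)

text \<open>The almost everywhere property that replaces the Lebesgue points of \<open>f\<close>.\<close>

definition approachable :: "('a \<Rightarrow> real) \<Rightarrow> 'a \<Rightarrow> bool" where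
  "approachable f x \<longleftrightarrow> (\<forall>e>0. \<forall>\<tau>>0. \<exists>t. 0 < t \<and> t < \<tau> \<and> mosc f t x < ennreal e)"

text \<open>At most three quarters of the measure of the ball are removed, and this measure is
  positive and finite.\<close>

lemma exists_outside:
  assumes "0 < r" "A \<in> sets M" "B \<in> sets M" "C \<in> sets M"
    and "4 * emeasure M A \<le> emeasure M (ball p r)" "4 * emeasure M B \<le> emeasure M (ball p r)"
    "4 * emeasure M C \<le> emeasure M (ball p r)"
  shows "\<exists>u\<in>ball p r. u \<notin> A \<and> u \<notin> B \<and> u \<notin> C"
proof (rule ccontr)
  let ?b = "emeasure M (ball p r)"
  assume "\<not> ?thesis"
  then have "?b \<le> emeasure M (A \<union> B \<union> C)"
    using assms by (intro emeasure_mono) auto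
  also have "\<dots> \<le> emeasure M A + emeasure M B + emeasure M C"
    using assms by (intro order.trans[OF emeasure_subadditive] add_right_mono emeasure_subadditive) auto
  finally have "4 * ?b \<le> 4 * (emeasure M A + emeasure M B + emeasure M C)" by (rule mult_left_mono) simp
  also have "\<dots> = 4 * emeasure M A + 4 * emeasure M B + 4 * emeasure M C" by (simp add: algebra_simps)
  also have "\<dots> \<le> ?b + ?b + ?b" using assms by (intro add_mono)
  also have "\<dots> = 3 * ?b" proof -
    have "(3::ennreal) = 1 + 1 + 1" by simp
    then show ?thesis by (simp only: distrib_right mult_1)
  qed
  finally have "ennreal (4 * measure M (ball p r)) \<le> ennreal (3 * measure M (ball p r))"
    by (simp add: ball_emeasure ennreal_mult)
  then show False using ball_pos[OF assms(1), of p] by simp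
qed

context
  fixes f :: "'a \<Rightarrow> real"
  assumes f [measurable]: "f \<in> borel_measurable M"
begin

lemma bad_set:
  assumes "0 < r"
  shows "{z\<in>ball x r. \<not> good f r z} \<in> sets M"
    and "4 * emeasure M {z\<in>ball x r. \<not> good f r z} < emeasure M (ball x r)"
proof -
  show "{z\<in>ball x r. \<not> good f r z} \<in> sets M"
    unfolding good_def by measurable
  have "emeasure M {z\<in>ball x r. \<not> good f r z} < ennreal (vol r)"
    unfolding good_def nu_def not_le E_X_eq
    using assms vol_pos ball_finite by (intro weak_type) auto
  then have "4 * emeasure M {z\<in>ball x r. \<not> good f r z} < 4 * ennreal (vol r)"
    by (intro ennreal_mult_strict_left_mono) auto
  also have "\<dots> \<le> emeasure M (ball x r)" using vol_le assms by simp
  finally show "4 * emeasure M {z\<in>ball x r. \<not> good f r z} < emeasure M (ball x r)" .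
qed

text \<open>The point \<open>p\<close> lies in \<open>ball z s\<close> and
  \<open>s \<le> 4 * r\<close>, so \<open>ball z s\<close> is contained in
  \<open>ball p (8 * r)\<close>. Hence the mean of \<open>\<bar>f z - f w\<bar>\<close> over
  \<open>ball p r\<close> is at most \<open>C2 * 8 powr n\<close> times the oscillation at
  \<open>z\<close>, and Markov's inequality applies. The base point \<open>z\<close> may be any
  fixed point.\<close>

lemma far_set:
  assumes "0 < r" "ball p r \<subseteq> ball z s" "s \<le> 4 * r"
  shows "{w\<in>ball p r. \<not> ennreal \<bar>f z - f w\<bar> \<le> ennreal K * mosc f s z} \<in> sets M"
    and "4 * emeasure M {w\<in>ball p r. \<not> ennreal \<bar>f z - f w\<bar> \<le> ennreal K * mosc f s z}
      \<le> emeasure M (ball p r)"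
proof -
  let ?K = "C2 * 8 powr n"
  show "{w\<in>ball p r. \<not> ennreal \<bar>f z - f w\<bar> \<le> ennreal K * mosc f s z} \<in> sets M"
    by measurable
  have p: "p \<in> ball z s" using assms(1,2) by (meson centre_in_ball subsetD)
  have "0 < s" using p by (auto intro: le_less_trans[OF zero_le_dist])
  have "ball z s \<subseteq> ball p (8 * r)"
  proof
    fix w assume "w \<in> ball z s"
    then show "w \<in> ball p (8 * r)" using p assms(3) dist_triangle3[of p w z] by (simp add: dist_commute)
  qed
  then have "measure M (ball z s) \<le> measure M (ball p (8 * r))" by (rule measure_ball_mono)
  also have "\<dots> \<le> ?K * measure M (ball p r)" using upper[of r 8 p] assms by simp
  finally have m: "emeasure M (ball z s) \<le> ennreal ?K * emeasure M (ball p r)"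
    using C2_ge by (simp add: ball_emeasure ennreal_leI flip: ennreal_mult)
  have "(\<integral>\<^sup>+w\<in>ball p r. ennreal \<bar>f z - f w\<bar> \<partial>M) \<le> (\<integral>\<^sup>+w\<in>ball z s. ennreal \<bar>f z - f w\<bar> \<partial>M)"
    using assms by (intro nn_integral_mono) (auto simp: indicator_def)
  also have "\<dots> = mosc f s z * emeasure M (ball z s)"
    using ball_pos[of s z] \<open>0 < s\<close> by (simp add: mosc_def ennreal_divide_times ball_emeasure mult_divide_eq_ennreal)
  also have "\<dots> \<le> (mosc f s z * ennreal ?K) * emeasure M (ball p r)"
    using mult_left_mono[OF m, of "mosc f s z"] by (simp add: ac_simps)
  finally have "4 * emeasure M {w\<in>ball p r. 4 * (mosc f s z * ennreal ?K) < ennreal \<bar>f z - f w\<bar>}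
      \<le> emeasure M (ball p r)"
    by (intro markov_quarter) auto
  moreover have "4 * (mosc f s z * ennreal ?K) = ennreal K * mosc f s z"
    using C2_ge by (simp add: K_def ennreal_mult ac_simps)
  ultimately show "4 * emeasure M {w\<in>ball p r. \<not> ennreal \<bar>f z - f w\<bar> \<le> ennreal K * mosc f s z}
      \<le> emeasure M (ball p r)" by (simp add: not_le)
qed

lemma chain_step:
  assumes "0 < r" "ball p r \<subseteq> ball z s" "s \<le> 4 * r"
  shows "\<exists>u\<in>ball p r. good f r u \<and> ennreal \<bar>f z - f u\<bar> \<le> ennreal K * mosc f s z"
proof -
  let ?F = "{w\<in>ball p r. \<not> ennreal \<bar>f z - f w\<bar> \<le> ennreal K * mosc f s z}"
  \<comment> \<open>Only two exceptional sets occur here, so the empty set takes the third place in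
    \<open>exists_outside\<close>.\<close>
  have "\<exists>u\<in>ball p r. u \<notin> {z\<in>ball p r. \<not> good f r z} \<and> u \<notin> ?F \<and> u \<notin> {}"
    using bad_set[OF assms(1), of p] far_set[OF assms] by (intro exists_outside assms(1)) auto
  then show ?thesis by blast
qed

text \<open>The chain climbs from the finest ball to the coarsest. Goodness of the current point
  bounds the next increment by \<open>2 * K\<close> times the value of \<open>nu\<close> at its
  scale, and the new point is again chosen good at the doubled radius.\<close>

lemma chain:
  assumes "0 < R" "w \<in> ball x (R / 2 ^ J)" "good f (R / 2 ^ J) w"
  shows "\<exists>z\<in>ball x R. good f R z \<and> ennreal \<bar>f w - f z\<bar> \<le> ennreal (2 * K) * (\<Sum>j\<le>J. nu f (R / 2 ^ j))"
  using assms(2,3)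
proof (induction J arbitrary: w)
  case 0
  then show ?case by (intro bexI[of _ w]) auto
next
  case (Suc J)
  let ?r = "R / 2 ^ J"
  have "ball x ?r \<subseteq> ball w (4 * (R / 2 ^ Suc J))"
  proof
    fix u assume "u \<in> ball x ?r"
    moreover have "dist x w < ?r / 2" using Suc.prems by (simp add: field_simps)
    moreover have "0 < ?r" using assms by simp
    ultimately have "dist w u < 2 * ?r" using dist_triangle3[of w u x] by (simp del: zero_less_divide_iff)
    then show "u \<in> ball w (4 * (R / 2 ^ Suc J))" by simp
  qed
  then obtain u where u: "u \<in> ball x ?r" "good f ?r u"
    "ennreal \<bar>f w - f u\<bar> \<le> ennreal K * mosc f (4 * (R / 2 ^ Suc J)) w"
    using chain_step[of ?r x w "4 * (R / 2 ^ Suc J)"] assms by (auto simp: field_simps)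
  note u(3)
  also have "ennreal K * mosc f (4 * (R / 2 ^ Suc J)) w \<le> ennreal K * (2 * nu f (R / 2 ^ Suc J))"
    using Suc.prems by (intro mult_left_mono) (auto simp: good_def)
  also have "\<dots> = ennreal (2 * K) * nu f (R / 2 ^ Suc J)"
    using K_pos by (simp add: ennreal_mult ac_simps)
  finally have wu: "ennreal \<bar>f w - f u\<bar> \<le> ennreal (2 * K) * nu f (R / 2 ^ Suc J)" .
  obtain z where z: "z \<in> ball x R" "good f R z"
    "ennreal \<bar>f u - f z\<bar> \<le> ennreal (2 * K) * (\<Sum>j\<le>J. nu f (R / 2 ^ j))"
    using Suc.IH u by blast
  have "ennreal \<bar>f w - f z\<bar> \<le> ennreal (2 * K) * nu f (R / 2 ^ Suc J) + ennreal (2 * K) * (\<Sum>j\<le>J. nu f (R / 2 ^ j))"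
    using abs_triangle_ennreal[of "f w" "f z" "f u"] add_mono[OF wu z(3)] by (rule order.trans)
  also have "\<dots> = ennreal (2 * K) * (\<Sum>j\<le>Suc J. nu f (R / 2 ^ j))" by (simp add: distrib_left add.commute)
  finally show ?case using z by blast
qed

text \<open>A small scale \<open>t\<close> at which \<open>x\<close> has little oscillation is
  rounded down to a dyadic scale. One step from \<open>x\<close> itself then reaches a good point at
  cost at most \<open>e\<close>, and from there \<open>chain\<close> leads up to radius
  \<open>R\<close>.\<close>

lemma approach:
  assumes "approachable f x" "0 < R" "0 < e"
  shows "\<exists>z\<in>ball x R. good f R z \<and>
    ennreal \<bar>f x - f z\<bar> \<le> ennreal e + ennreal (2 * K) * (\<Sum>j. nu f (R / 2 ^ j))"
proof -
  let ?D = "C2 * 2 powr n"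
  have D: "0 < ?D" using C2_ge by simp
  \<comment> \<open>This divisor absorbs the factor \<open>K\<close> of the first step and the
    doubling factor \<open>?D\<close> lost in rounding \<open>t\<close>.\<close>
  have "0 < e / (K * ?D)" by (intro divide_pos_pos mult_pos_pos K_pos D assms(3))
  then obtain t where t: "0 < t" "t < R" "mosc f t x < ennreal (e / (K * ?D))"
    using assms(1,2) unfolding approachable_def by blast
  obtain j where j: "R / 2 ^ j \<le> t" "t \<le> 2 * (R / 2 ^ j)" using dyadic_scale t by blast
  let ?r = "R / 2 ^ j"
  have "0 < ?r" using assms by simp
  then obtain w where w: "w \<in> ball x ?r" "good f ?r w" "ennreal \<bar>f x - f w\<bar> \<le> ennreal K * mosc f ?r x"
    using chain_step[of ?r x x ?r] by auto
  note w(3)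
  also have "ennreal K * mosc f ?r x \<le> ennreal K * (ennreal ?D * mosc f t x)"
    using j \<open>0 < ?r\<close> by (intro mult_left_mono mosc_doubling) auto
  also have "\<dots> \<le> ennreal K * (ennreal ?D * ennreal (e / (K * ?D)))"
    using t by (intro mult_left_mono) auto
  also have "\<dots> = ennreal e"
  proof -
    have "a * (b * (e / (a * b))) = e" if "0 < a" "0 < b" for a b :: real
      using that by simp
    from this[OF K_pos D] have "ennreal (K * (?D * (e / (K * ?D)))) = ennreal e" by (rule arg_cong)
    then show ?thesis
      by (simp only: ennreal_mult'[OF less_imp_le[OF K_pos]] ennreal_mult'[OF less_imp_le[OF D]])
  qed
  finally have xw: "ennreal \<bar>f x - f w\<bar> \<le> ennreal e" .
  obtain z where z: "z \<in> ball x R" "good f R z"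
    "ennreal \<bar>f w - f z\<bar> \<le> ennreal (2 * K) * (\<Sum>i\<le>j. nu f (R / 2 ^ i))"
    using chain[OF assms(2) w(1,2)] by blast
  note z(3)
  also have "ennreal (2 * K) * (\<Sum>i\<le>j. nu f (R / 2 ^ i)) \<le> ennreal (2 * K) * (\<Sum>i. nu f (R / 2 ^ i))"
    by (intro mult_left_mono sum_le_suminf) auto
  finally have "ennreal \<bar>f x - f w\<bar> + ennreal \<bar>f w - f z\<bar> \<le> ennreal e + ennreal (2 * K) * (\<Sum>i. nu f (R / 2 ^ i))"
    using xw by (intro add_mono)
  then show ?thesis using z abs_triangle_ennreal[of "f x" "f z" "f w"] by (blast intro: order.trans)
qed

text \<open>The chains from \<open>x\<close> and \<open>y\<close> end in good points
  \<open>z\<close> and \<open>w\<close> at scale \<open>R\<close>. Both are close in value to most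
  of \<open>ball x R\<close>, hence to a common point \<open>u\<close>. Each of the four increments
  costs at most \<open>2 * K\<close> times the sum, up to \<open>e / 2\<close> on the two
  chains.\<close>

lemma oscillation_le_sum:
  assumes x: "approachable f x" and y: "approachable f y" and R: "0 < R" "dist x y \<le> R"
  shows "ennreal \<bar>f x - f y\<bar> \<le> ennreal (8 * K) * (\<Sum>j. nu f (R / 2 ^ j))"
proof (rule ennreal_le_epsilon)
  fix e :: real assume "0 < e"
  let ?S = "\<Sum>j. nu f (R / 2 ^ j)"
  obtain z where z: "z \<in> ball x R" "good f R z"
    "ennreal \<bar>f x - f z\<bar> \<le> ennreal (e / 2) + ennreal (2 * K) * ?S"
    using approach[OF x R(1), of "e / 2"] \<open>0 < e\<close> by auto
  obtain w where w: "w \<in> ball y R" "good f R w"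
    "ennreal \<bar>f y - f w\<bar> \<le> ennreal (e / 2) + ennreal (2 * K) * ?S"
    using approach[OF y R(1), of "e / 2"] \<open>0 < e\<close> by auto
  have z4: "ball x R \<subseteq> ball z (4 * R)"
  proof
    fix u assume "u \<in> ball x R"
    then show "u \<in> ball z (4 * R)" using z(1) R(1) dist_triangle3[of z u x] by simp
  qed
  \<comment> \<open>Points of \<open>ball x R\<close> are at distance less than \<open>3 * R\<close>
    from \<open>w\<close>, since \<open>w\<close> is within \<open>R\<close> of \<open>y\<close> and
    \<open>y\<close> within \<open>R\<close> of \<open>x\<close>.\<close>
  have w4: "ball x R \<subseteq> ball w (4 * R)"
  proof
    fix u assume "u \<in> ball x R"
    then show "u \<in> ball w (4 * R)"
      using w(1) R dist_triangle3[of w u y] dist_triangle[of y u x] by (simp add: dist_commute)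
  qed
  let ?F = "\<lambda>z. {v\<in>ball x R. \<not> ennreal \<bar>f z - f v\<bar> \<le> ennreal K * mosc f (4 * R) z}"
  have "\<exists>u\<in>ball x R. u \<notin> ?F z \<and> u \<notin> ?F w \<and> u \<notin> {}"
    using far_set[OF R(1) z4] far_set[OF R(1) w4] by (intro exists_outside R(1)) auto
  then obtain u where u: "ennreal \<bar>f z - f u\<bar> \<le> ennreal K * mosc f (4 * R) z"
    "ennreal \<bar>f w - f u\<bar> \<le> ennreal K * mosc f (4 * R) w"
    by blast
  have nu: "nu f R \<le> ?S"
    using sum_le_suminf[of "\<lambda>j. nu f (R / 2 ^ j)" "{0}"] by simp
  have level: "ennreal K * mosc f (4 * R) v \<le> ennreal (2 * K) * ?S" if "good f R v" for v
  proof -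
    have "mosc f (4 * R) v \<le> 2 * ?S"
      using that mult_left_mono[OF nu, of 2] unfolding good_def by (auto intro: order.trans)
    then have "ennreal K * mosc f (4 * R) v \<le> ennreal K * (2 * ?S)"
      by (rule mult_left_mono) simp
    then show ?thesis using K_pos by (simp add: ennreal_mult ac_simps)
  qed
  have "ennreal \<bar>f x - f y\<bar> \<le> ennreal (\<bar>f x - f z\<bar> + \<bar>f z - f u\<bar> + \<bar>f w - f u\<bar> + \<bar>f y - f w\<bar>)"
    by (intro ennreal_leI) simp
  also have "\<dots> = ennreal \<bar>f x - f z\<bar> + ennreal \<bar>f z - f u\<bar> + ennreal \<bar>f w - f u\<bar> + ennreal \<bar>f y - f w\<bar>"
    by simp
  also have "\<dots> \<le> (ennreal (e / 2) + ennreal (2 * K) * ?S) + ennreal (2 * K) * ?S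
      + ennreal (2 * K) * ?S + (ennreal (e / 2) + ennreal (2 * K) * ?S)"
    by (intro add_mono z(3) w(3) order.trans[OF u(1) level[OF z(2)]] order.trans[OF u(2) level[OF w(2)]])
  also have "\<dots> = (ennreal (e / 2) + ennreal (e / 2)) + (4 * ennreal (2 * K)) * ?S"
  proof -
    have "(4::ennreal) = 1 + 1 + 1 + 1" by simp
    then have "a + c + c + c + (a + c) = (a + a) + 4 * c" for a c :: ennreal
      by (simp only: distrib_right mult_1 add_ac)
    then show ?thesis by (simp only: mult.assoc)
  qed
  also have "\<dots> = ennreal (8 * K) * ?S + ennreal e"
  proof -
    have "4 * ennreal (2 * K) = ennreal (8 * K)"
      using K_pos ennreal_mult[of 4 "2 * K"] by simp
    moreover have "ennreal (e / 2) + ennreal (e / 2) = ennreal e"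
      using \<open>0 < e\<close> by (simp flip: ennreal_plus)
    ultimately show ?thesis by (simp only: add.commute)
  qed
  finally show "ennreal \<bar>f x - f y\<bar> \<le> ennreal (8 * K) * ?S + ennreal e" .
qed

end

section \<open>Almost every point is approachable\<close>

lemma nu_tendsto_0:
  assumes "(\<Sum>j. nu f (R / 2 ^ j)) < \<infinity>"
  shows "(\<lambda>j. nu f (R / 2 ^ j)) \<longlonglongrightarrow> 0"
proof (rule tendsto_sandwich[OF _ _ tendsto_const ennreal_suminf_tail_tendsto_0[OF assms]])
  show "\<forall>\<^sub>F i in sequentially. nu f (R / 2 ^ i) \<le> (\<Sum>j. nu f (R / 2 ^ (j + i)))"
    using sum_le_suminf[of "\<lambda>j. nu f (R / 2 ^ (j + i))" "{0}" for i] by (intro always_eventually) auto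
qed simp

lemma AE_approachable:
  assumes f [measurable]: "f \<in> borel_measurable M" and "0 < R"
    and fin: "(\<Sum>j. nu f (R / 2 ^ j)) < \<infinity>"
  shows "AE x in M. approachable f x"
proof -
  define r where "r i = 4 * (R / 2 ^ i)" for i :: nat
  have r0: "r \<longlonglongrightarrow> 0"
    unfolding r_def using LIMSEQ_divide_realpow_zero[of 2 "4 * R"] by simp
  \<comment> \<open>As \<open>phi\<close> is increasing, the fixed value \<open>phi (vol R)\<close>
    dominates the denominators of all smaller scales. So convergence of \<open>nu\<close> to zero
    passes to the norms of the oscillations.\<close>
  have lim: "(\<lambda>i. phi (vol R) * nu f (R / 2 ^ i)) \<longlonglongrightarrow> phi (vol R) * 0"
    using phi_finite by (intro ennreal_tendsto_cmult nu_tendsto_0 fin) auto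
  have le: "N (mosc f (r i)) \<le> phi (vol R) * nu f (R / 2 ^ i)" for i
  proof -
    let ?p = "phi (vol (R / 2 ^ i))"
    have "0 < R / 2 ^ i" "R / 2 ^ i \<le> R" using \<open>0 < R\<close> by (auto simp: field_simps)
    then have "vol (R / 2 ^ i) \<le> vol R" "0 < ?p"
      using c0_pos rho_mono vol_pos by (auto simp: vol_def intro!: phi_pos)
    moreover have "N (mosc f (r i)) = ?p * nu f (R / 2 ^ i)"
      unfolding nu_def E_X_eq r_def
      using \<open>0 < ?p\<close> phi_finite[of "vol (R / 2 ^ i)"] by (simp add: ennreal_times_divide mult_divide_eq_ennreal mult.commute[of ?p])
    ultimately show ?thesis by (simp add: phi_mono mult_right_mono)
  qed
  have N0: "(\<lambda>i. N (mosc f (r i))) \<longlonglongrightarrow> 0"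
    using tendsto_sandwich[OF _ _ tendsto_const lim[unfolded mult_zero_right]] le by simp
  obtain x0 :: 'a where True by blast
  have "AE x in M. x \<in> ball x0 (real m) \<longrightarrow> liminf (\<lambda>i. mosc f (r i) x) = 0" for m
  proof -
    let ?B = "ball x0 (real m)"
    \<comment> \<open>On a ball the norm controls the integral, so the integrals of the oscillations
      tend to zero and Fatou's lemma yields a vanishing lower limit almost everywhere.\<close>
    obtain C where C: "\<And>u. u \<in> borel_measurable M \<Longrightarrow> (\<integral>\<^sup>+x\<in>?B. u x \<partial>M) \<le> ennreal C * N u"
      using N_local[OF ball_in_sets ball_finite] by blast
    have lim: "(\<lambda>i. ennreal C * N (mosc f (r i))) \<longlonglongrightarrow> ennreal C * 0"
      by (intro ennreal_tendsto_cmult N0) auto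
    have "(\<lambda>i. \<integral>\<^sup>+x\<in>?B. mosc f (r i) x \<partial>M) \<longlonglongrightarrow> 0"
      using tendsto_sandwich[OF _ _ tendsto_const lim[unfolded mult_zero_right]] C by simp
    then have "liminf (\<lambda>i. \<integral>\<^sup>+x\<in>?B. mosc f (r i) x \<partial>M) = 0"
      by (intro lim_imp_Liminf) auto
    moreover have "(\<integral>\<^sup>+x. liminf (\<lambda>i. mosc f (r i) x * indicator ?B x) \<partial>M) \<le> liminf (\<lambda>i. \<integral>\<^sup>+x\<in>?B. mosc f (r i) x \<partial>M)"
      by (intro nn_integral_liminf) auto
    ultimately have "AE x in M. liminf (\<lambda>i. mosc f (r i) x * indicator ?B x) = 0"
      by (subst nn_integral_0_iff_AE[symmetric]) auto
    then show ?thesis by eventually_elim (auto simp: indicator_def split: if_splits)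
  qed
  then have "AE x in M. \<forall>m. x \<in> ball x0 (real m) \<longrightarrow> liminf (\<lambda>i. mosc f (r i) x) = 0"
    unfolding AE_all_countable by blast
  then show ?thesis
  proof eventually_elim
    case (elim x)
    obtain m where "dist x0 x < real m" using reals_Archimedean2 by blast
    then have lim: "liminf (\<lambda>i. mosc f (r i) x) = 0" using elim by auto
    show ?case unfolding approachable_def
    proof (intro allI impI, rule ccontr)
      fix e \<tau> :: real assume "0 < e" "0 < \<tau>" and no: "\<nexists>t. 0 < t \<and> t < \<tau> \<and> mosc f t x < ennreal e"
      have "\<forall>\<^sub>F i in sequentially. r i < \<tau>" using order_tendstoD(2)[OF r0 \<open>0 < \<tau>\<close>] .
      then have "\<forall>\<^sub>F i in sequentially. ennreal e \<le> mosc f (r i) x"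
      proof eventually_elim
        case (elim i)
        moreover have "0 < r i" using \<open>0 < R\<close> by (simp add: r_def)
        ultimately show ?case using no not_less by blast
      qed
      then have "ennreal e \<le> 0" unfolding lim[symmetric] by (rule Liminf_bounded)
      then show False using \<open>0 < e\<close> by simp
    qed
  qed
qed

text \<open>One null set serves all \<open>R\<close>: if no dyadic sum is finite, the bound is vacuous.\<close>

lemma oscillation_bound_off_null_set:
  assumes f: "f \<in> borel_measurable M"
  shows "\<exists>Z\<in>null_sets M. \<forall>x\<in>UNIV - Z. \<forall>y\<in>UNIV - Z. \<forall>R>0. dist x y \<le> R \<longrightarrow>
    ennreal \<bar>f x - f y\<bar> \<le> ennreal (8 * K) * (\<Sum>j. nu f (R / 2 ^ j))"
proof (cases "\<exists>R>0. (\<Sum>j. nu f (R / 2 ^ j)) < \<infinity>")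
  case True
  then have "AE x in M. approachable f x" using AE_approachable f by blast
  then obtain Z where "Z \<in> null_sets M" "\<And>x. x \<notin> Z \<Longrightarrow> approachable f x"
    by (elim AE_E) (auto simp: null_sets_def subset_iff)
  then show ?thesis using oscillation_le_sum[OF f] by (intro bexI[of _ Z]) auto
next
  case False
  then have "(\<Sum>j. nu f (R / 2 ^ j)) = top" if "0 < R" for R
    using that by (metis infinity_ennreal_def less_top)
  then show ?thesis using K_pos
    by (intro bexI[of _ "{}"]) (auto simp: ennreal_mult_top)
qed

section \<open>Comparison of the dyadic sum with the integral\<close>

definition integrand :: "('a \<Rightarrow> real) \<Rightarrow> real \<Rightarrow> ennreal" where
  "integrand f s = E_X M N f s / phi (rho s) / ennreal s"

text \<open>Three comparisons on \<open>{4 * r..<8 * r}\<close> are combined: \<open>E_X\<close> at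
  \<open>4 * r\<close> and at \<open>s\<close> by doubling, \<open>1 / (8 * r)\<close> and
  \<open>1 / s\<close> directly, and the denominators by subadditivity of \<open>phi\<close>, since
  \<open>rho s\<close> is at most a constant multiple of \<open>vol r\<close>.\<close>

lemma nu_le_integrand:
  "\<exists>c>0. \<forall>f\<in>borel_measurable M. \<forall>r>0. \<forall>s\<in>{4 * r..<8 * r}.
     nu f r / ennreal (8 * r) \<le> ennreal c * integrand f s"
proof -
  let ?D = "C2 * 2 powr n"
  define m where "m = nat \<lceil>8 powr n * 4 / c0\<rceil>"
  let ?L = "real (Suc m)"
  have D: "0 < ?D" using C2_ge by simp
  have L: "8 powr n * 4 / c0 \<le> ?L" unfolding m_def by linarith
  show ?thesis
  proof (intro exI[of _ "?D * ?L"] conjI ballI allI impI)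
    show "0 < ?D * ?L" by (intro mult_pos_pos[OF D]) simp
    fix f :: "'a \<Rightarrow> real" and r s :: real
    assume f: "f \<in> borel_measurable M" and r: "0 < r" and s: "s \<in> {4 * r..<8 * r}"
    have s0: "0 < s" using r s by simp
    obtain a where a: "0 < a" "phi (vol r) = ennreal a"
      using phi_pos[OF vol_pos[OF r]] phi_finite[of "vol r"] by (cases "phi (vol r)") auto
    obtain b where b: "0 < b" "phi (rho s) = ennreal b"
      using phi_pos[OF rho_pos[OF s0]] phi_finite[of "rho s"] by (cases "phi (rho s)") auto
    have "rho s \<le> 8 powr n * rho r"
      using rho_mono[of s "8 * r"] rho_scale[OF r] s s0 by simp
    also have "\<dots> = (8 powr n * 4 / c0) * vol r" using c0_pos by (simp add: vol_def)
    also have "\<dots> \<le> ?L * vol r"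
      using L vol_pos[OF r] by (intro mult_right_mono) auto
    finally have "phi (rho s) \<le> phi (?L * vol r)" by (rule phi_mono)
    also have "\<dots> \<le> of_nat (Suc m) * phi (vol r)" using vol_pos[OF r] by (intro phi_multiple) simp
    also have "of_nat (Suc m) = ennreal ?L" by (simp only: ennreal_of_nat_eq_real_of_nat)
    finally have "ennreal b \<le> ennreal (?L * a)" using a b by (simp add: ennreal_mult')
    then have ba: "b \<le> ?L * a" using a by (subst (asm) ennreal_le_iff) auto
    have coeff: "1 / a / (8 * r) \<le> ?L / b / s"
    proof -
      have "b * s \<le> (?L * a) * (8 * r)" using ba s s0 b a r by (intro mult_mono) auto
      then have "1 / (a * (8 * r)) \<le> ?L / (b * s)"
        using a b r s0 by (simp add: field_simps)
      then show ?thesis by simp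
    qed
    have "nu f r / ennreal (8 * r) = E_X M N f (4 * r) * ennreal (1 / a / (8 * r))"
      using a r by (simp add: nu_def divide_ennreal_def inverse_ennreal inverse_eq_divide mult.assoc flip: ennreal_mult')
    also have "\<dots> \<le> (ennreal ?D * E_X M N f s) * ennreal (?L / b / s)"
      using f r s coeff by (intro mult_mono E_X_doubling ennreal_leI) auto
    also have "\<dots> = ennreal ?D * (E_X M N f s * (ennreal ?L * ennreal (1 / b / s)))"
    proof -
      have "ennreal (?L / b / s) = ennreal ?L * ennreal (1 / b / s)"
        by (subst ennreal_mult'[symmetric]) auto
      then show ?thesis by (simp only: mult.assoc)
    qed
    also have "\<dots> = ennreal (?D * ?L) * (E_X M N f s * ennreal (1 / b / s))"
      by (subst ennreal_mult'[OF less_imp_le[OF D]]) (simp only: ac_simps)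
    also have "E_X M N f s * ennreal (1 / b / s) = integrand f s"
      using b s0 by (simp add: integrand_def divide_ennreal_def inverse_ennreal inverse_eq_divide mult.assoc flip: ennreal_mult')
    finally show "nu f r / ennreal (8 * r) \<le> ennreal (?D * ?L) * integrand f s" .
  qed
qed

text \<open>Only step functions are integrated, because \<open>E_X M N f\<close> is not known to be measurable; for
  other functions \<open>nn_integral\<close> is merely a monotone lower integral.\<close>

lemma sum_le_integral:
  "\<exists>c>0. \<forall>f\<in>borel_measurable M. \<forall>R>0. (\<Sum>j. nu f (R / 2 ^ j)) \<le>
     ennreal c * (\<integral>\<^sup>+s\<in>{0<..<8 * R}. integrand f s \<partial>lborel)"
proof -
  obtain c where c: "0 < c" "\<And>f r s. f \<in> borel_measurable M \<Longrightarrow> 0 < r \<Longrightarrow> s \<in> {4 * r..<8 * r} \<Longrightarrow>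
     nu f r / ennreal (8 * r) \<le> ennreal c * integrand f s"
    using nu_le_integrand by blast
  show ?thesis
  proof (intro exI[of _ "2 * c"] conjI ballI allI impI)
    fix f :: "'a \<Rightarrow> real" and R :: real assume f: "f \<in> borel_measurable M" and R: "0 < R"
    define r where "r j = R / 2 ^ j" for j :: nat
    define b where "b j = nu f (r j) / ennreal (8 * r j) / ennreal c" for j
    have r: "0 < r j" for j using R by (simp add: r_def)
    have b_le: "b j \<le> integrand f s" if "s \<in> {4 * r j..<8 * r j}" for j s
    proof -
      have "b j \<le> ennreal c * integrand f s / ennreal c"
        unfolding b_def using c(2)[OF f r that] by (rule divide_right_mono_ennreal)
      also have "\<dots> = integrand f s"
        using c(1) by (simp add: mult.commute[of "ennreal c"] ennreal_mult_divide_eq)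
      finally show ?thesis .
    qed
    \<comment> \<open>The interval has length \<open>4 * r j\<close>, half of the divisor
      \<open>8 * r j\<close> in \<open>b j\<close>; this accounts for the factor 2 in
      \<open>2 * c\<close>.\<close>
    have nu: "nu f (r j) = ennreal (2 * c) * (\<integral>\<^sup>+s. b j * indicator {4 * r j..<8 * r j} s \<partial>lborel)" for j
    proof -
      have b: "b j = nu f (r j) * ennreal (1 / (8 * r j * c))"
        using r[of j] c(1)
        by (simp add: b_def divide_ennreal_def inverse_ennreal inverse_eq_divide mult.assoc flip: ennreal_mult')
      have "ennreal (2 * c) * (\<integral>\<^sup>+s. b j * indicator {4 * r j..<8 * r j} s \<partial>lborel)
        = ennreal (2 * c) * (b j * ennreal (4 * r j))"
        using r[of j] by (simp add: nn_integral_cmult_indicator)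
      also have "\<dots> = nu f (r j) * ennreal (2 * c * (1 / (8 * r j * c) * (4 * r j)))"
      proof -
        have "ennreal x * (v * ennreal y * ennreal z) = v * ennreal (x * (y * z))"
          if "0 \<le> x" "0 \<le> y" for x y z v
          using that by (simp add: ennreal_mult' ac_simps)
        then show ?thesis unfolding b using r[of j] c(1) by simp
      qed
      also have "\<dots> = nu f (r j)"
        using r[of j] c(1) by simp
      finally show ?thesis by (rule sym)
    qed
    \<comment> \<open>For \<open>i < j\<close> the upper end \<open>8 * r j\<close> does not exceed
      \<open>4 * r i\<close>. So at each \<open>s\<close> at most one step contributes, and the sum
      of steps stays below the integrand.\<close>
    have disjoint: "i = j" if "s \<in> {4 * r i..<8 * r i}" "s \<in> {4 * r j..<8 * r j}" for i j s
    proof (rule ccontr)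
      have less: False if "i < j" "4 * r i \<le> s" "s < 8 * r j" for i j
      proof -
        have "(2::real) ^ Suc i \<le> 2 ^ j" using that by (intro power_increasing) auto
        then have "r j \<le> R / 2 ^ Suc i" unfolding r_def using R by (intro divide_left_mono) auto
        then show False using that by (simp add: r_def)
      qed
      assume "i \<noteq> j"
      then show False using less[of i j] less[of j i] that by fastforce
    qed
    have "(\<Sum>j. nu f (R / 2 ^ j)) = (\<Sum>j. nu f (r j))" by (simp add: r_def)
    also have "\<dots> = ennreal (2 * c) * (\<Sum>j. \<integral>\<^sup>+s. b j * indicator {4 * r j..<8 * r j} s \<partial>lborel)"
      by (subst nu) simp
    also have "\<dots> = ennreal (2 * c) * (\<integral>\<^sup>+s. (\<Sum>j. b j * indicator {4 * r j..<8 * r j} s) \<partial>lborel)"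
      by (subst nn_integral_suminf) auto
    also have "\<dots> \<le> ennreal (2 * c) * (\<integral>\<^sup>+s\<in>{0<..<8 * R}. integrand f s \<partial>lborel)"
    proof (intro mult_left_mono nn_integral_mono)
      fix s :: real
      show "(\<Sum>j. b j * indicator {4 * r j..<8 * r j} s) \<le> integrand f s * indicator {0<..<8 * R} s"
      proof (cases "\<exists>j. s \<in> {4 * r j..<8 * r j}")
        case True
        then obtain j where j: "s \<in> {4 * r j..<8 * r j}" by blast
        have "r j \<le> R" using R by (simp add: r_def field_simps)
        then have "s \<in> {0<..<8 * R}" using j r[of j] by auto
        have "(\<Sum>i. b i * indicator {4 * r i..<8 * r i} s) = (\<Sum>i\<in>{j}. b i * indicator {4 * r i..<8 * r i} s)"
          using disjoint[OF j] by (intro suminf_finite) (auto simp: indicator_def)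
        also have "\<dots> = b j" using j by simp
        also have "\<dots> \<le> integrand f s" by (rule b_le[OF j])
        finally show ?thesis using \<open>s \<in> {0<..<8 * R}\<close> by simp
      next
        case False
        then have "(\<lambda>j. b j * indicator {4 * r j..<8 * r j} s) = (\<lambda>j. 0)"
          by (auto simp: indicator_def)
        then show ?thesis by simp
      qed
    qed simp
    finally show "(\<Sum>j. nu f (R / 2 ^ j)) \<le> ennreal (2 * c) * (\<integral>\<^sup>+s\<in>{0<..<8 * R}. integrand f s \<partial>lborel)" .
  qed (use c in auto)
qed

section \<open>Continuity of a representative and the final estimate\<close>

lemma null_set_dense:
  assumes "Z \<in> null_sets M" shows "closure (UNIV - Z) = UNIV"
proof -
  have "\<exists>y\<in>UNIV - Z. dist y x < e" if "0 < e" for x e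
  proof (rule ccontr)
    assume "\<not> ?thesis"
    then have "ball x e \<subseteq> Z" by (auto simp: dist_commute[of x])
    then have "emeasure M (ball x e) = 0" using assms by (metis ball_in_sets null_setsD1 null_sets_subset)
    then show False using ball_pos[OF that, of x] by (simp add: ball_emeasure)
  qed
  then show ?thesis by (auto simp: closure_approachable)
qed

text \<open>For points closer than \<open>R / 2 ^ i\<close> the dyadic sum started at that radius is
  a tail of the convergent one, hence small. So \<open>f\<close> is uniformly continuous off a null
  set, which has dense complement, and extends continuously to the whole space.\<close>

lemma essentially_continuous_if_sum_finite:
  assumes f: "f \<in> borel_measurable M" and R: "0 < R" and fin: "(\<Sum>j. nu f (R / 2 ^ j)) < \<infinity>"
  shows "essentially_continuous M f"
proof -
  obtain Z where Z: "Z \<in> null_sets M"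
    and osc: "\<And>x y R. x \<notin> Z \<Longrightarrow> y \<notin> Z \<Longrightarrow> 0 < R \<Longrightarrow> dist x y \<le> R \<Longrightarrow>
      ennreal \<bar>f x - f y\<bar> \<le> ennreal (8 * K) * (\<Sum>j. nu f (R / 2 ^ j))"
    using oscillation_bound_off_null_set[OF f] by auto
  have lim: "(\<lambda>i. ennreal (8 * K) * (\<Sum>j. nu f (R / 2 ^ (j + i)))) \<longlonglongrightarrow> ennreal (8 * K) * 0"
    by (intro ennreal_tendsto_cmult ennreal_suminf_tail_tendsto_0 fin) auto
  have "uniformly_continuous_on (UNIV - Z) f"
    unfolding uniformly_continuous_on_def
  proof (intro allI impI)
    fix e :: real assume "0 < e"
    then have "\<forall>\<^sub>F i in sequentially. ennreal (8 * K) * (\<Sum>j. nu f (R / 2 ^ (j + i))) < ennreal e"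
      using lim by (intro order_tendstoD(2)) auto
    then obtain i where i: "ennreal (8 * K) * (\<Sum>j. nu f (R / 2 ^ (j + i))) < ennreal e"
      using eventually_happens' trivial_limit_sequentially by blast
    show "\<exists>d>0. \<forall>x\<in>UNIV - Z. \<forall>y\<in>UNIV - Z. dist y x < d \<longrightarrow> dist (f y) (f x) < e"
    proof (intro exI[of _ "R / 2 ^ i"] conjI ballI impI)
      show "0 < R / 2 ^ i" using R by simp
      fix x y assume "x \<in> UNIV - Z" "y \<in> UNIV - Z" "dist y x < R / 2 ^ i"
      then have "ennreal \<bar>f y - f x\<bar> \<le> ennreal (8 * K) * (\<Sum>j. nu f (R / 2 ^ i / 2 ^ j))"
        using R by (intro osc) auto
      also have "(\<lambda>j. R / 2 ^ i / 2 ^ j) = (\<lambda>j. R / 2 ^ (j + i))"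
        by (simp add: power_add mult.commute)
      also note i
      finally show "dist (f y) (f x) < e" using \<open>0 < e\<close> by (simp add: dist_real_def ennreal_less_iff)
    qed
  qed
  then obtain g where "uniformly_continuous_on (closure (UNIV - Z)) g" "\<And>x. x \<in> UNIV - Z \<Longrightarrow> f x = g x"
    using uniformly_continuous_on_extension_on_closure by metis
  then show ?thesis unfolding essentially_continuous_def null_set_dense[OF Z]
    using Z by (intro exI[of _ g]) (auto intro: uniformly_continuous_imp_continuous intro!: AE_I'[of Z])
qed

lemma oscillation_theorem:
  "(\<exists>C::real. 0 < C \<and>
      (\<forall>f \<in> bfs M N \<inter> Linfty M. \<exists>Z\<in>null_sets M. \<forall>x\<in>UNIV - Z. \<forall>y\<in>UNIV - Z.
         ennreal \<bar>f x - f y\<bar> \<le> ennreal C *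
           (\<integral>\<^sup>+s\<in>{0<..<8 * dist x y}.
              (E_X M N f s / fundamental_function M N (min (s powr k) (s powr n)) / ennreal s)
            \<partial>lborel))) \<and>
    (\<forall>f \<in> bfs M N \<inter> Linfty M.
       (\<integral>\<^sup>+s\<in>{0<..<1}. (E_X M N f s / fundamental_function M N (s powr n) / ennreal s) \<partial>lborel) < \<infinity>
       \<longrightarrow> essentially_continuous M f)"
proof -
  obtain c where c: "0 < c" and le: "\<And>f R. f \<in> borel_measurable M \<Longrightarrow> 0 < R \<Longrightarrow>
      (\<Sum>j. nu f (R / 2 ^ j)) \<le> ennreal c * (\<integral>\<^sup>+s\<in>{0<..<8 * R}. integrand f s \<partial>lborel)"
    using sum_le_integral by blast
  have int: "E_X M N f s / fundamental_function M N (min (s powr k) (s powr n)) / ennreal s = integrand f s" for f s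
    by (simp add: integrand_def rho_def)
  show ?thesis unfolding int
  proof (intro conjI exI[of _ "8 * K * c"] ballI impI)
    show "0 < 8 * K * c" using K_pos c by simp
    fix f assume "f \<in> bfs M N \<inter> Linfty M"
    then have f: "f \<in> borel_measurable M" by (simp add: bfs_def)
    obtain Z where Z: "Z \<in> null_sets M"
      and osc: "\<And>x y R. x \<notin> Z \<Longrightarrow> y \<notin> Z \<Longrightarrow> 0 < R \<Longrightarrow> dist x y \<le> R \<Longrightarrow>
        ennreal \<bar>f x - f y\<bar> \<le> ennreal (8 * K) * (\<Sum>j. nu f (R / 2 ^ j))"
      using oscillation_bound_off_null_set[OF f] by auto
    have "ennreal \<bar>f x - f y\<bar> \<le> ennreal (8 * K * c) * (\<integral>\<^sup>+s\<in>{0<..<8 * dist x y}. integrand f s \<partial>lborel)"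
      if "x \<notin> Z" "y \<notin> Z" for x y
    proof (cases "x = y")
      \<comment> \<open>The radius \<open>dist x y\<close> is used, which is positive here; for
        equal points the left side is zero.\<close>
      case False
      then have "ennreal \<bar>f x - f y\<bar> \<le> ennreal (8 * K) * (\<Sum>j. nu f (dist x y / 2 ^ j))"
        using that by (intro osc) auto
      also have "\<dots> \<le> ennreal (8 * K) * (ennreal c * (\<integral>\<^sup>+s\<in>{0<..<8 * dist x y}. integrand f s \<partial>lborel))"
        using False by (intro mult_left_mono le f) auto
      finally show ?thesis using K_pos c by (simp add: ennreal_mult' mult.assoc)
    qed simp
    then show "\<exists>Z\<in>null_sets M. \<forall>x\<in>UNIV - Z. \<forall>y\<in>UNIV - Z. ennreal \<bar>f x - f y\<bar> \<le>
        ennreal (8 * K * c) * (\<integral>\<^sup>+s\<in>{0<..<8 * dist x y}. integrand f s \<partial>lborel)"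
      using Z by auto
  next
    fix f assume "f \<in> bfs M N \<inter> Linfty M"
      and fin: "(\<integral>\<^sup>+s\<in>{0<..<1}. (E_X M N f s / fundamental_function M N (s powr n) / ennreal s) \<partial>lborel) < \<infinity>"
    then have f: "f \<in> borel_measurable M" by (simp add: bfs_def)
    \<comment> \<open>Below 1 the larger exponent gives the smaller power, so the integrability
      hypothesis is the one for \<open>integrand\<close>. The radius \<open>1 / 8\<close> used below
      makes \<open>8 * R\<close> equal to 1.\<close>
    have "rho s = s powr n" if "0 < s" "s < 1" for s
      using that k_le_n powr_mono'[of k n s] by (simp add: rho_def min_def)
    then have "(\<integral>\<^sup>+s\<in>{0<..<1}. integrand f s \<partial>lborel)
      = (\<integral>\<^sup>+s\<in>{0<..<1}. (E_X M N f s / fundamental_function M N (s powr n) / ennreal s) \<partial>lborel)"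
      by (intro nn_integral_cong) (auto simp: integrand_def indicator_def)
    then have "ennreal c * (\<integral>\<^sup>+s\<in>{0<..<1}. integrand f s \<partial>lborel) < \<infinity>"
      using fin by (simp add: ennreal_mult_less_top)
    then have "(\<Sum>j. nu f (1 / 8 / 2 ^ j)) < \<infinity>"
      using le[OF f, of "1 / 8"] by (simp add: le_less_trans)
    then show "essentially_continuous M f"
      by (intro essentially_continuous_if_sum_finite[OF f, of "1 / 8"]) auto
  qed
qed

end

theorem theorem19:
  fixes M :: "'a::metric_space measure"
    and N :: "('a \<Rightarrow> ennreal) \<Rightarrow> ennreal"
    and k n :: real
  assumes "RD_space M k n" and "non_collapsing M" and "ri_space M N"
  shows "(\<exists>C::real. 0 < C \<and>
      (\<forall>f \<in> bfs M N \<inter> Linfty M. \<exists>Z\<in>null_sets M. \<forall>x\<in>UNIV - Z. \<forall>y\<in>UNIV - Z.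
         ennreal \<bar>f x - f y\<bar> \<le> ennreal C *
           (\<integral>\<^sup>+s\<in>{0<..<8 * dist x y}.
              (E_X M N f s / fundamental_function M N (min (s powr k) (s powr n)) / ennreal s)
            \<partial>lborel))) \<and>
    (\<forall>f \<in> bfs M N \<inter> Linfty M.
       (\<integral>\<^sup>+s\<in>{0<..<1}. (E_X M N f s / fundamental_function M N (s powr n) / ennreal s) \<partial>lborel) < \<infinity>
       \<longrightarrow> essentially_continuous M f)"
proof -
  let ?m = "\<lambda>x r. measure M (ball x r)"
  have borel: "sets borel \<subseteq> sets M"
    and fin: "\<And>x r. 0 < r \<Longrightarrow> emeasure M (ball x r) < \<infinity>"
    and kn: "0 < k" "k \<le> n"
    using assms(1) by (auto simp: RD_space_def metric_measure_space_def)
  obtain C1 C2 where C: "0 < C1" "C1 \<le> 1" "1 \<le> C2"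
    and low: "\<And>x r l. 0 < r \<Longrightarrow> 1 \<le> l \<Longrightarrow>
          ennreal (C1 * l powr k) * emeasure M (ball x r) \<le> emeasure M (ball x (l * r))"
    and up: "\<And>x r l. 0 < r \<Longrightarrow> 1 \<le> l \<Longrightarrow>
          emeasure M (ball x (l * r)) \<le> ennreal (C2 * l powr n) * emeasure M (ball x r)"
    using assms(1) unfolding RD_space_def by blast
  \<comment> \<open>Balls of nonpositive radius are empty.\<close>
  have fin': "emeasure M (ball x r) < \<infinity>" for x r
    using fin[of r x] by (cases "0 < r") (auto simp: ball_empty)
  have m: "emeasure M (ball x r) = ennreal (?m x r)" for x r
    using fin'[of x r] by (simp add: emeasure_eq_ennreal_measure less_top)
  define i where "i = (INF x. emeasure M (ball x 1))"
  have i: "0 < i" "\<And>x. i \<le> emeasure M (ball x 1)"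
    using assms(2) by (auto simp: non_collapsing_def i_def intro: INF_lower)
  \<comment> \<open>The infimum lies below the finite measure of a unit ball, so the non-collapsing
    constant is a positive real.\<close>
  then have "i < \<infinity>" using fin' le_less_trans by blast
  then obtain m0 where m0: "0 < m0" "i = ennreal m0" using i by (cases i) auto
  interpret rd_ri M k n C1 C2 m0 N
  proof
    show "C1 * l powr k * ?m x r \<le> ?m x (l * r)" if "0 < r" "1 \<le> l" for x r l
      using low[OF that, of x] C by (simp add: m flip: ennreal_mult')
    show "?m x (l * r) \<le> C2 * l powr n * ?m x r" if "0 < r" "1 \<le> l" for x r l
      using up[OF that, of x] C by (simp add: m flip: ennreal_mult')
    show "m0 \<le> ?m x 1" for x
      using i(2)[of x] by (simp add: m m0)
  qed (use borel fin' kn C m0 assms(3) in auto)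
  show ?thesis by (rule oscillation_theorem)
qed

end
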